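(* Let $T:\mathbb{T}\to\mathbb{T}$ be a $C^4$ uniformly expanding map with transfer operator $L_T:L^1(\mathbb{T})\to L^1(\mathbb{T})$, having an invariant probability density $h_0\in W^{3,1}(\mathbb{T})$ such that $W_{h_0}=0$. Let $\phi\mapsto\psi_\phi$ be a map assigning to each $\phi\in L^1(\mathbb{T})$ a probability density $\psi_\phi\in W^{2,1}(\mathbb{T})$, such that $\sup_{\phi\in P_w}\|\psi_\phi\|_{W^{2,1}}<\infty$ and, for some $C\ge0$, $\|\psi_{\phi+g}-\psi_\phi\|_{W^{1,1}}\le C\|g\|_{L^1}$ for all $\phi\in P_w$ and $g\in V_{L^1}$. Let $\tilde\phi\in L^1(\mathbb{T})$ with $W_{\tilde\phi}>0$, and suppose that $\phi\mapsto\psi_\phi$ is differentiable at $\tilde\phi$: there is a bounded linear $\dot\psi_{\tilde\phi}:L^1\to W^{2,1}$ such that $$\lim_{g\in V_{L^1},\ \|g\|_{L^1}\to0}\frac{\|\psi_{\tilde\phi+g}-\psi_{\tilde\phi}-\dot\psi_{\tilde\phi}(g)\|_{W^{1,1}}}{\|g\|_{L^1}}=0,$$ and $\|\dot\psi_{\tilde\phi}\|_{L^1\to W^{1,1}}<1$. Then there is $0<\bar\delta<1$ such that for each $0\le\delta\le\bar\delta$ the self-consistent transfer operator $\mathcal{L}_\delta$ has only $h_0$ as invariant probability density in $L^1$.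
   Context: $\mathbb{T}$ is the circle, parametrized as $\mathbb{R}/2\pi\mathbb{Z}$ so that $e^{ix}$ is well defined. A $C^4$ map $T$ of the circle is uniformly expanding if there is $\sigma>1$ with $|T'(x)|>\sigma$ for all $x$; its transfer operator is $L_Tf(x)=\sum_{y\in T^{-1}(x)}f(y)/|T'(y)|$. $P_w$ is the set of probability densities in $L^1(\mathbb{T})$ and $V_{L^1}=\{g\in L^1(\mathbb{T}):\int g\,dx=0\}$. For $\phi\in L^1$, $W_\phi=\left|\int_{\mathbb{T}}e^{ix}\phi(x)\,dx\right|^2$. For $\delta\ge0$ and $\phi\in L^1$ define $L_{\delta,\phi}:L^1\to L^1$ by $$L_{\delta,\phi}(f)=\begin{cases}(1-\delta W_\phi)L_T(f)+\left[\delta W_\phi\int f\,dx\right]\psi_\phi & \text{when }\delta W_\phi\le1,\\ \psi_\phi\int f\,dx & \text{when }\delta W_\phi>1,\end{cases}$$ and $\mathcal{L}_\delta(f)=L_{\delta,f}(f)$. An invariant probability density of $\mathcal{L}_\delta$ is $f\in P_w$ with $\mathcal{L}_\delta(f)=f$. *)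

theory Defs
  imports "HOL-Analysis.Analysis"
begin

section \<open>The space \<open>L\<^sup>1\<close> of the circle\<close>

text \<open>
  The circle \<open>\<real>/2\<pi>\<int>\<close> is represented by the fundamental domain \<open>[0, 2\<pi>)\<close> with Lebesgue measure
  (not normalised: the total mass is \<open>2\<pi>\<close>). Elements of \<open>L\<^sup>1\<close> are classes of integrable functions
  modulo almost-everywhere equality; values of representatives outside \<open>[0, 2\<pi>)\<close> are irrelevant.
\<close>

abbreviation circle :: "real measure" where
  "circle \<equiv> lebesgue_on {0..<2 * pi}"

definition eq_L1 :: "(real \<Rightarrow> real) \<Rightarrow> (real \<Rightarrow> real) \<Rightarrow> bool" where
  "eq_L1 f g \<longleftrightarrow> integrable circle f \<and> integrable circle g \<and> (AE x in circle. f x = g x)"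

lemma part_equivp_eq_L1: "part_equivp eq_L1"
proof (rule part_equivpI)
  show "\<exists>f. eq_L1 f f"
    by (rule exI[of _ "\<lambda>_. 0"]) (simp add: eq_L1_def)
  show "symp eq_L1"
    by (rule sympI) (auto simp: eq_L1_def)
  show "transp eq_L1"
    by (rule transpI) (auto simp: eq_L1_def)
qed

quotient_type L1 = "real \<Rightarrow> real" / partial: eq_L1
  by (rule part_equivp_eq_L1)

instantiation L1 :: real_normed_vector
begin

lift_definition zero_L1 :: L1 is "\<lambda>_. 0"
  by (simp add: eq_L1_def)

lift_definition plus_L1 :: "L1 \<Rightarrow> L1 \<Rightarrow> L1" is "\<lambda>f g x. f x + g x"
  by (auto simp: eq_L1_def)

lift_definition minus_L1 :: "L1 \<Rightarrow> L1 \<Rightarrow> L1" is "\<lambda>f g x. f x - g x"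
  by (auto simp: eq_L1_def)

lift_definition uminus_L1 :: "L1 \<Rightarrow> L1" is "\<lambda>f x. - f x"
  by (auto simp: eq_L1_def)

lift_definition scaleR_L1 :: "real \<Rightarrow> L1 \<Rightarrow> L1" is "\<lambda>c f x. c * f x"
  by (auto simp: eq_L1_def)

lift_definition norm_L1 :: "L1 \<Rightarrow> real" is "\<lambda>f. LINT x|circle. \<bar>f x\<bar>"
  unfolding eq_L1_def by (intro integral_cong_AE) auto

definition dist_L1 :: "L1 \<Rightarrow> L1 \<Rightarrow> real" where
  "dist_L1 f g = norm (f - g)"

definition sgn_L1 :: "L1 \<Rightarrow> L1" where
  "sgn_L1 f = inverse (norm f) *\<^sub>R f"

definition uniformity_L1 :: "(L1 \<times> L1) filter" where
  "uniformity_L1 = (INF e\<in>{0<..}. principal {(f, g). dist f g < e})"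

definition open_L1 :: "L1 set \<Rightarrow> bool" where
  "open_L1 U \<longleftrightarrow> (\<forall>f\<in>U. \<forall>\<^sub>F (f', g) in uniformity. f' = f \<longrightarrow> g \<in> U)"

instance
proof
  fix f g h :: L1 and a b :: real and U :: "L1 set"
  show "f + g + h = f + (g + h)"
    by transfer (auto simp: eq_L1_def)
  show "f + g = g + f"
    by transfer (auto simp: eq_L1_def)
  show "0 + f = f"
    by transfer (auto simp: eq_L1_def)
  show "- f + f = 0"
    by transfer (auto simp: eq_L1_def)
  show "f - g = f + - g"
    by transfer (auto simp: eq_L1_def)
  show "a *\<^sub>R (f + g) = a *\<^sub>R f + a *\<^sub>R g"
    by transfer (auto simp: eq_L1_def algebra_simps)
  show "(a + b) *\<^sub>R f = a *\<^sub>R f + b *\<^sub>R f"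
    by transfer (auto simp: eq_L1_def algebra_simps)
  show "a *\<^sub>R b *\<^sub>R f = (a * b) *\<^sub>R f"
    by transfer (auto simp: eq_L1_def algebra_simps)
  show "1 *\<^sub>R f = f"
    by transfer (auto simp: eq_L1_def)
  show "dist f g = norm (f - g)"
    by (rule dist_L1_def)
  show "sgn f = inverse (norm f) *\<^sub>R f"
    by (rule sgn_L1_def)
  show "uniformity = (INF e\<in>{0<..}. principal {(f::L1, g). dist f g < e})"
    by (rule uniformity_L1_def)
  show "open U \<longleftrightarrow> (\<forall>f\<in>U. \<forall>\<^sub>F (f', g) in uniformity. f' = f \<longrightarrow> g \<in> U)"
    by (rule open_L1_def)
  show "norm f = 0 \<longleftrightarrow> f = 0"
    by transfer (simp add: eq_L1_def integral_nonneg_eq_0_iff_AE)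
  show "norm (f + g) \<le> norm f + norm g"
  proof transfer
    fix f g :: "real \<Rightarrow> real"
    assume "eq_L1 f f" "eq_L1 g g"
    then have int: "integrable circle (\<lambda>x. \<bar>f x\<bar>)" "integrable circle (\<lambda>x. \<bar>g x\<bar>)"
      "integrable circle (\<lambda>x. \<bar>f x + g x\<bar>)"
      by (auto simp: eq_L1_def)
    have "(LINT x|circle. \<bar>f x + g x\<bar>) \<le> (LINT x|circle. \<bar>f x\<bar> + \<bar>g x\<bar>)"
      using int by (intro integral_mono) auto
    also have "\<dots> = (LINT x|circle. \<bar>f x\<bar>) + (LINT x|circle. \<bar>g x\<bar>)"
      using int by simp
    finally show "(LINT x|circle. \<bar>f x + g x\<bar>) \<le> (LINT x|circle. \<bar>f x\<bar>) + (LINT x|circle. \<bar>g x\<bar>)" .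
  qed
  show "norm (a *\<^sub>R f) = \<bar>a\<bar> * norm f"
    by transfer (simp add: abs_mult)
qed

end

lift_definition integral_L1 :: "L1 \<Rightarrow> real" is "\<lambda>f. LINT x|circle. f x"
  unfolding eq_L1_def by (intro integral_cong_AE) auto

lift_definition nonneg_L1 :: "L1 \<Rightarrow> bool" is "\<lambda>f. AE x in circle. 0 \<le> f x"
proof -
  fix f g :: "real \<Rightarrow> real"
  assume "eq_L1 f g"
  then have "AE x in circle. f x = g x"
    by (simp add: eq_L1_def)
  then have "AE x in circle. 0 \<le> f x \<longleftrightarrow> 0 \<le> g x"
    by eventually_elim simp
  then show "(AE x in circle. 0 \<le> f x) \<longleftrightarrow> (AE x in circle. 0 \<le> g x)"
    by (rule eventually_subst)
qed

definition prob_densities :: "L1 set" where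
  "prob_densities = {f. nonneg_L1 f \<and> integral_L1 f = 1}"

definition zero_mean :: "L1 set" where
  "zero_mean = {g. integral_L1 g = 0}"


section \<open>Sobolev spaces \<open>W\<^sup>k\<^sup>,\<^sup>1\<close> of the circle\<close>

definition C_k :: "nat \<Rightarrow> (real \<Rightarrow> real) \<Rightarrow> bool" where
  "C_k k u \<longleftrightarrow> (\<forall>i<k. (deriv ^^ i) u differentiable_on UNIV) \<and> continuous_on UNIV ((deriv ^^ k) u)"

definition test_function :: "(real \<Rightarrow> real) \<Rightarrow> bool" where
  "test_function u \<longleftrightarrow> (\<forall>k. C_k k u) \<and> (\<forall>x. u (x + 2 * pi) = u x)"

lemma integral_mult_cong_L1:
  fixes f g v :: "real \<Rightarrow> real"
  assumes "eq_L1 f g" "continuous_on UNIV v"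
  shows "(LINT x|circle. f x * v x) = (LINT x|circle. g x * v x)"
proof (rule integral_cong_AE)
  have [measurable]: "v \<in> borel_measurable circle"
    using assms(2)
    by (intro continuous_imp_measurable_on_sets_lebesgue) (auto intro: continuous_on_subset)
  have [measurable]: "f \<in> borel_measurable circle" "g \<in> borel_measurable circle"
    using assms(1) by (auto simp: eq_L1_def)
  show "(\<lambda>x. f x * v x) \<in> borel_measurable circle" "(\<lambda>x. g x * v x) \<in> borel_measurable circle"
    by measurable
  show "AE x in circle. f x * v x = g x * v x"
    using assms(1) by (auto simp: eq_L1_def)
qed

lemma test_function_continuous: "test_function u \<Longrightarrow> continuous_on UNIV ((deriv ^^ k) u)"
  by (simp add: test_function_def C_k_def)

lift_definition has_weak_deriv :: "nat \<Rightarrow> L1 \<Rightarrow> L1 \<Rightarrow> bool" is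
  "\<lambda>k f g. \<forall>u. test_function u \<longrightarrow>
     (LINT x|circle. f x * (deriv ^^ k) u x) = (- 1) ^ k * (LINT x|circle. g x * u x)"
proof -
  fix k :: nat and f f' g g' :: "real \<Rightarrow> real"
  assume f: "eq_L1 f f'" and g: "eq_L1 g g'"
  have "(LINT x|circle. f x * (deriv ^^ k) u x) = (LINT x|circle. f' x * (deriv ^^ k) u x)"
    "(LINT x|circle. g x * u x) = (LINT x|circle. g' x * u x)" if "test_function u" for u
    using integral_mult_cong_L1[OF f test_function_continuous[OF that, of k]]
      integral_mult_cong_L1[OF g test_function_continuous[OF that, of 0]] by simp_all
  then show "(\<forall>u. test_function u \<longrightarrow> (LINT x|circle. f x * (deriv ^^ k) u x) =
        (- 1) ^ k * (LINT x|circle. g x * u x)) \<longleftrightarrow>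
      (\<forall>u. test_function u \<longrightarrow> (LINT x|circle. f' x * (deriv ^^ k) u x) =
        (- 1) ^ k * (LINT x|circle. g' x * u x))"
    by simp
qed

definition sobolev :: "nat \<Rightarrow> L1 set" where
  "sobolev k = {f. \<forall>i\<le>k. \<exists>g. has_weak_deriv i f g}"

text \<open>Weak derivatives are unique as elements of \<open>L\<^sup>1\<close>, so the description below is proper on
  \<^term>\<open>sobolev k\<close>; the norm is meaningful only there.\<close>

definition sobolev_norm :: "nat \<Rightarrow> L1 \<Rightarrow> real" where
  "sobolev_norm k f = (\<Sum>i\<le>k. norm (THE g. has_weak_deriv i f g))"

definition bounded_linear_sobolev :: "nat \<Rightarrow> (L1 \<Rightarrow> L1) \<Rightarrow> bool" where
  "bounded_linear_sobolev k A \<longleftrightarrow> linear A \<and> range A \<subseteq> sobolev k \<and>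
     (\<exists>K. \<forall>g. sobolev_norm k (A g) \<le> K * norm g)"

text \<open>The analogue of \<^const>\<open>onorm\<close> for the Sobolev norm on the target.\<close>

definition sobolev_onorm :: "nat \<Rightarrow> (L1 \<Rightarrow> L1) \<Rightarrow> real" where
  "sobolev_onorm k A = (SUP g. sobolev_norm k (A g) / norm g)"


section \<open>Expanding circle maps and self-consistent transfer operators\<close>

text \<open>
  A \<open>C\<^sup>4\<close> map of the circle is given by a lift \<open>T\<close> to the real line, \<open>d\<close> being its degree. Its
  derivative as a circle map is the (\<open>2\<pi>\<close>-periodic) derivative of the lift.
\<close>

definition C4_circle_map :: "(real \<Rightarrow> real) \<Rightarrow> bool" where
  "C4_circle_map T \<longleftrightarrow> C_k 4 T \<and> (\<exists>d::int. \<forall>x. T (x + 2 * pi) = T x + 2 * pi * of_int d)"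

definition uniformly_expanding :: "(real \<Rightarrow> real) \<Rightarrow> bool" where
  "uniformly_expanding T \<longleftrightarrow> (\<exists>\<sigma>>1. \<forall>x. \<bar>deriv T x\<bar> > \<sigma>)"

definition circle_preimage :: "(real \<Rightarrow> real) \<Rightarrow> real \<Rightarrow> real set" where
  "circle_preimage T x = {y \<in> {0..<2 * pi}. \<exists>m::int. T y = x + 2 * pi * of_int m}"

text \<open>
  For a uniformly expanding \<open>C\<^sup>4\<close> circle map the preimages are finite, and the sum is integrable and,
  up to null sets, independent of the representative of \<open>f\<close>.
\<close>

definition transfer_operator :: "(real \<Rightarrow> real) \<Rightarrow> L1 \<Rightarrow> L1" where
  "transfer_operator T f =
     abs_L1 (\<lambda>x. \<Sum>y\<in>circle_preimage T x. rep_L1 f y / \<bar>deriv T y\<bar>)"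

lift_definition W :: "L1 \<Rightarrow> real" is
  "\<lambda>f. (cmod (LINT x|circle. cis x * complex_of_real (f x)))\<^sup>2"
proof -
  fix f g :: "real \<Rightarrow> real"
  assume "eq_L1 f g"
  then have [measurable]: "f \<in> borel_measurable circle" "g \<in> borel_measurable circle"
    and ae: "AE x in circle. f x = g x"
    by (auto simp: eq_L1_def)
  have [measurable]: "cis \<in> borel_measurable circle"
    by (intro continuous_imp_measurable_on_sets_lebesgue continuous_intros) auto
  have "(LINT x|circle. cis x * complex_of_real (f x)) =
      (LINT x|circle. cis x * complex_of_real (g x))"
    using ae by (intro integral_cong_AE) auto
  then show "(cmod (LINT x|circle. cis x * complex_of_real (f x)))\<^sup>2 =
      (cmod (LINT x|circle. cis x * complex_of_real (g x)))\<^sup>2"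
    by simp
qed

definition L_frozen ::
  "(real \<Rightarrow> real) \<Rightarrow> (L1 \<Rightarrow> L1) \<Rightarrow> real \<Rightarrow> L1 \<Rightarrow> L1 \<Rightarrow> L1" where
  "L_frozen T \<psi> \<delta> \<phi> f =
     (if \<delta> * W \<phi> \<le> 1
      then (1 - \<delta> * W \<phi>) *\<^sub>R transfer_operator T f + (\<delta> * W \<phi> * integral_L1 f) *\<^sub>R \<psi> \<phi>
      else integral_L1 f *\<^sub>R \<psi> \<phi>)"

definition L_self_consistent ::
  "(real \<Rightarrow> real) \<Rightarrow> (L1 \<Rightarrow> L1) \<Rightarrow> real \<Rightarrow> L1 \<Rightarrow> L1" where
  "L_self_consistent T \<psi> \<delta> f = L_frozen T \<psi> \<delta> f f"

definition invariant_densities :: "(L1 \<Rightarrow> L1) \<Rightarrow> L1 set" where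
  "invariant_densities L = {f \<in> prob_densities. L f = f}"

end

theory Submission
  imports Defs
begin

text \<open>
  Let \<open>f\<close> be an invariant density of \<open>\<L>\<^sub>\<delta>\<close> and \<open>\<epsilon> = \<delta> W f\<close>. Then \<open>G = f - h\<^sub>0\<close> satisfies
  \<open>G = (1 - \<epsilon>) L G + \<epsilon> F\<close> with \<open>F = \<psi> f - h\<^sub>0\<close>. The functions \<open>F\<close> have mean zero and are uniformly bounded
  in \<open>W\<^sup>2\<^sup>,\<^sup>1\<close>, hence uniformly Lipschitz, so \<open>\<parallel>L\<^sup>n F\<parallel>\<close> decays exponentially at a uniform rate and
  \<open>\<parallel>G\<parallel> \<le> A \<epsilon>\<close> if \<open>\<epsilon> > 0\<close>. As \<open>W h\<^sub>0 = 0\<close>, this gives \<open>W f \<le> \<parallel>G\<parallel>\<^sup>2 \<le> (A \<delta>)\<^sup>2 (W f)\<^sup>2 \<le> (A \<delta>)\<^sup>2 W f\<close>, which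
  for \<open>A \<delta> < 1\<close> forces \<open>W f = 0\<close>. Then \<open>f\<close> is invariant under \<open>L\<close>, and equals \<open>h\<^sub>0\<close> because differences
  of invariant densities are approximated by zero-mean Lipschitz functions, which decay.

  The decay is a Doeblin argument on the cones \<open>f x \<le> exp (a \<bar>x - y\<bar>) f y\<close>: by bounded distortion \<open>L\<close>
  maps such a cone into a strictly narrower one, so the images of two densities of the cone share
  a fixed constant part, and the remainders stay in the cone.
\<close>

section \<open>Integrable functions on the circle\<close>

text \<open>The obstacle is that \<open>f\<close> is only integrable, so no rate of decay is
  available for \<open>G\<close> itself; decay is used on the forcing term \<open>F\<close> alone.
  When \<epsilon> > 0, iterating the equation damps the remainder by
  \<open>(1 - \<epsilon>) ^ n\<close>, and contraction of \<open>L\<close> in \<open>L1\<close> is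
  all that is asked of \<open>G\<close>. At \<epsilon> = 0 this damping is lost, hence the separate
  approximation argument. One bound on \<delta> serves all densities because the rate depends on the
  map only and the constant is linear in the Lipschitz constant. Distances are measured on the real
  line with a lift of the map: its inverse is global, so every inverse branch is one function
  evaluated at translated points. Trigonometric polynomials, written \<open>p (cis x)\<close>, are
  at once test functions, Lipschitz, and dense in \<open>L1\<close>; they carry the uniqueness of
  weak derivatives, integration by parts and the approximation of differences of invariant
  densities.\<close>

lemma eq_L1_refl_iff: "eq_L1 f f \<longleftrightarrow> integrable circle f"
  by (simp add: eq_L1_def)

lemma abs_L1_eqI:
  assumes "integrable circle f" "integrable circle g" "AE x in circle. f x = g x"
  shows "abs_L1 f = abs_L1 g"
  using assms Quotient3_rel_abs[OF Quotient3_L1] by (simp add: eq_L1_def)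

lemma integrable_rep_L1: "integrable circle (rep_L1 F)"
  using Quotient3_rel_rep[OF Quotient3_L1, of F F] by (simp add: eq_L1_def)

lemma abs_rep_L1: "abs_L1 (rep_L1 F) = F"
  by (rule Quotient3_abs_rep[OF Quotient3_L1])

lemma rep_abs_L1_AE:
  assumes "integrable circle f"
  shows "AE x in circle. rep_L1 (abs_L1 f) x = f x"
  using rep_abs_rsp_left[OF Quotient3_L1, of f f] assms by (simp add: eq_L1_def)

lemma L1_cases:
  obtains f where "integrable circle f" "F = abs_L1 f"
  using integrable_rep_L1 abs_rep_L1 by metis

context
  fixes f :: "real \<Rightarrow> real"
  assumes f: "integrable circle f"
begin

lemma norm_abs_L1: "norm (abs_L1 f) = (LINT x|circle. \<bar>f x\<bar>)"
  using norm_L1.abs_eq f by (simp add: eq_L1_refl_iff)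

lemma integral_abs_L1: "integral_L1 (abs_L1 f) = (LINT x|circle. f x)"
  using integral_L1.abs_eq f by (simp add: eq_L1_refl_iff)

lemma W_abs_L1: "W (abs_L1 f) = (cmod (LINT x|circle. cis x * complex_of_real (f x)))\<^sup>2"
  using W.abs_eq f by (simp add: eq_L1_refl_iff)

lemma scaleR_abs_L1: "c *\<^sub>R abs_L1 f = abs_L1 (\<lambda>x. c * f x)"
  using scaleR_L1.abs_eq f by (simp add: eq_L1_refl_iff)

lemma plus_abs_L1: "integrable circle g \<Longrightarrow> abs_L1 f + abs_L1 g = abs_L1 (\<lambda>x. f x + g x)"
  using plus_L1.abs_eq f by (simp add: eq_L1_refl_iff)

lemma minus_abs_L1: "integrable circle g \<Longrightarrow> abs_L1 f - abs_L1 g = abs_L1 (\<lambda>x. f x - g x)"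
  using minus_L1.abs_eq f by (simp add: eq_L1_refl_iff)

lemma has_weak_deriv_abs_L1:
  "integrable circle g \<Longrightarrow> has_weak_deriv k (abs_L1 f) (abs_L1 g) \<longleftrightarrow>
    (\<forall>u. test_function u \<longrightarrow>
     (LINT x|circle. f x * (deriv ^^ k) u x) = (- 1) ^ k * (LINT x|circle. g x * u x))"
  using has_weak_deriv.abs_eq f by (simp add: eq_L1_refl_iff)

end

lemma integral_L1_diff: "integral_L1 (F - G) = integral_L1 F - integral_L1 G"
  by transfer (simp add: eq_L1_def)

lemma norm_nonneg_L1: "nonneg_L1 F \<Longrightarrow> norm F = integral_L1 F"
  by transfer (auto simp: eq_L1_def intro!: integral_cong_AE elim: eventually_mono)

lemma norm_prob_density: "F \<in> prob_densities \<Longrightarrow> norm F = 1"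
  by (simp add: prob_densities_def norm_nonneg_L1)

lemma measure_circle [simp]: "measure circle {0..<2 * pi} = 2 * pi"
  by (simp add: measure_restrict_space)

lemma finite_measure_circle: "finite_measure circle"
  by (rule finite_measure_lebesgue_on) (auto simp: bounded_set_imp_lmeasurable)

lemma integrable_const_circle [simp]: "integrable circle (\<lambda>x. c :: real)"
  by (rule finite_measure.integrable_const[OF finite_measure_circle])

lemma LINT_const_circle [simp]: "(LINT x|circle. c) = 2 * pi * (c :: real)"
  by simp

lemma continuous_on_measurable_circle:
  "continuous_on UNIV f \<Longrightarrow> f \<in> borel_measurable circle" for f :: "real \<Rightarrow> 'b::euclidean_space"
  by (intro continuous_imp_measurable_on_sets_lebesgue) (auto intro: continuous_on_subset)

lemma integrable_mult_bounded_circle: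
  fixes f v :: "real \<Rightarrow> real"
  assumes f: "integrable circle f" and [measurable]: "v \<in> borel_measurable circle"
    and v: "\<And>x. x \<in> {0..<2*pi} \<Longrightarrow> \<bar>v x\<bar> \<le> B"
  shows "integrable circle (\<lambda>x. f x * v x)"
proof (rule Bochner_Integration.integrable_bound)
  show "integrable circle (\<lambda>x. B * f x)"
    using f by simp
  show "(\<lambda>x. f x * v x) \<in> borel_measurable circle"
    using f by measurable
  have "\<bar>f x * v x\<bar> \<le> \<bar>B * f x\<bar>" if "x \<in> {0..<2*pi}" for x
    using mult_left_mono[OF v[OF that], of "\<bar>f x\<bar>"] order_trans[OF abs_ge_zero v[OF that]]
    by (simp add: abs_mult mult_ac)
  then show "AE x in circle. norm (f x * v x) \<le> norm (B * f x)"
    by (intro AE_I2) auto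
qed

lemma integrable_bounded_circle:
  fixes v :: "real \<Rightarrow> real"
  assumes "v \<in> borel_measurable circle" "\<And>x. x \<in> {0..<2*pi} \<Longrightarrow> \<bar>v x\<bar> \<le> B"
  shows "integrable circle v"
  using integrable_mult_bounded_circle[of "\<lambda>_. 1" v B] assms by simp

lemma bounded_on_circle:
  fixes f :: "real \<Rightarrow> real"
  assumes "continuous_on UNIV f"
  obtains B where "0 \<le> B" "\<And>x. x \<in> {0..<2*pi} \<Longrightarrow> \<bar>f x\<bar> \<le> B"
proof -
  have "compact (f ` {0..2*pi})"
    using assms by (intro compact_continuous_image) (auto intro: continuous_on_subset)
  then obtain B where "\<forall>y\<in>f ` {0..2*pi}. \<bar>y\<bar> \<le> B"
    using compact_imp_bounded bounded_real by metis
  then show ?thesis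
    by (intro that[of "max B 0"]) (auto simp: le_max_iff_disj)
qed

lemma integrable_mult_continuous_circle:
  fixes f v :: "real \<Rightarrow> real"
  assumes "integrable circle f" and v: "continuous_on UNIV v"
  shows "integrable circle (\<lambda>x. f x * v x)"
proof -
  obtain B where "\<And>x. x \<in> {0..<2*pi} \<Longrightarrow> \<bar>v x\<bar> \<le> B"
    using bounded_on_circle[OF v] by blast
  then show ?thesis
    by (rule integrable_mult_bounded_circle[OF assms(1) continuous_on_measurable_circle[OF v]])
qed

lemma integrable_continuous_circle:
  fixes v :: "real \<Rightarrow> real"
  shows "continuous_on UNIV v \<Longrightarrow> integrable circle v"
  using integrable_mult_continuous_circle[of "\<lambda>_. 1" v] by simp

lemma integrable_cis_mult:
  assumes f: "integrable circle f"
  shows "integrable circle (\<lambda>x. cis x * complex_of_real (f x))"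
proof (rule Bochner_Integration.integrable_bound[OF f])
  have [measurable]: "cis \<in> borel_measurable circle"
    by (intro continuous_on_measurable_circle continuous_intros)
  show "(\<lambda>x. cis x * complex_of_real (f x)) \<in> borel_measurable circle"
    using f by measurable
qed (simp add: norm_mult)

text \<open>Since \<open>H\<close> has no first Fourier coefficient, the coefficient of \<open>F\<close> is that of \<open>F - H\<close>.\<close>

lemma W_le_norm_diff:
  assumes "W H = 0"
  shows "W F \<le> (norm (F - H))\<^sup>2"
proof -
  obtain f where f: "integrable circle f" "F = abs_L1 f" by (rule L1_cases)
  obtain h where h: "integrable circle h" "H = abs_L1 h" by (rule L1_cases)
  have 0: "(LINT x|circle. cis x * complex_of_real (h x)) = 0"
    using assms h by (simp add: W_abs_L1)
  have "(LINT x|circle. cis x * complex_of_real (f x)) =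
      (LINT x|circle. cis x * complex_of_real (f x) - cis x * complex_of_real (h x))"
    using f h 0 by (subst Bochner_Integration.integral_diff) (auto intro: integrable_cis_mult)
  also have "\<dots> = (LINT x|circle. cis x * complex_of_real (f x - h x))"
    by (simp add: algebra_simps)
  also have "cmod \<dots> \<le> (LINT x|circle. cmod (cis x * complex_of_real (f x - h x)))"
    by (rule integral_norm_bound)
  also have "\<dots> = norm (F - H)"
    using f h by (simp add: minus_abs_L1 norm_abs_L1 norm_mult del: of_real_diff)
  finally show ?thesis
    using f by (simp add: W_abs_L1 power_mono)
qed

lemma W_zero: "W 0 = 0"
  by transfer simp

lemma W_nonneg: "0 \<le> W F"
  by transfer simp

lemma W_prob_density_le_1: "F \<in> prob_densities \<Longrightarrow> W F \<le> 1"
  using W_le_norm_diff[OF W_zero, of F] by (simp add: norm_prob_density)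

section \<open>The transfer operator of an expanding map\<close>

definition periodic :: "(real \<Rightarrow> real) \<Rightarrow> bool" where
  "periodic f \<longleftrightarrow> (\<forall>x. f (x + 2 * pi) = f x)"

text \<open>The increment is kept general: \<open>c = 0\<close> is periodicity,
  \<open>c = 2 * pi * of_int d\<close> is the behaviour of a lift of degree
  \<open>d\<close>.\<close>

lemma shift_by_int:
  fixes f :: "real \<Rightarrow> real"
  assumes f: "\<And>x. f (x + p) = f x + c"
  shows "f (x + p * of_int k) = f x + c * of_int k"
proof (induction k rule: int_induct[where k = 0])
  case (step1 i)
  then show ?case using f[of "x + p * of_int i"] by (simp add: algebra_simps)
next
  case (step2 i)
  then show ?case using f[of "x + p * of_int (i - 1)"] by (simp add: algebra_simps)
qed simp

lemma periodic_shift: "periodic f \<Longrightarrow> f (x + 2 * pi * of_int k) = f x"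
  using shift_by_int[of f "2 * pi" 0] by (simp add: periodic_def)

definition wrap :: "real \<Rightarrow> real" where
  "wrap x = x + 2 * pi * of_int (- \<lfloor>x / (2 * pi)\<rfloor>)"

lemma wrap_range: "wrap x \<in> {0..<2 * pi}"
  using floor_divide_lower[of "2 * pi" x] floor_divide_upper[of "2 * pi" x]
  by (simp add: wrap_def algebra_simps)

lemma wrap_shift: "wrap (x + 2 * pi * of_int k) = wrap x"
proof -
  have "(x + 2 * pi * of_int k) / (2 * pi) = x / (2 * pi) + of_int k"
    by (simp add: field_simps)
  then show ?thesis
    by (simp add: wrap_def algebra_simps)
qed

lemma wrap_id: "x \<in> {0..<2 * pi} \<Longrightarrow> wrap x = x"
  unfolding wrap_def by (subst floor_unique[of 0]) (auto simp: field_simps)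

lemma periodic_wrap: "periodic f \<Longrightarrow> f (wrap x) = f x"
  unfolding wrap_def by (rule periodic_shift)

lemma bounded_of_periodic:
  assumes "continuous_on UNIV f" "periodic f"
  obtains B where "0 \<le> B" "\<And>x. \<bar>f x\<bar> \<le> B"
  using bounded_on_circle[OF assms(1)] periodic_wrap[OF assms(2)] wrap_range by metis

lemma deriv_shift_eq:
  fixes f :: "real \<Rightarrow> real"
  assumes "\<And>x. f (x + p) = f x + c" "\<And>x. f field_differentiable (at x)"
  shows "deriv f (x + p) = deriv f x"
proof -
  have "((\<lambda>x. f (x + p)) has_field_derivative deriv f (x + p)) (at x)"
    using assms(2)[of "x + p"] by (simp add: DERIV_deriv_iff_field_differentiable[symmetric] DERIV_shift)
  moreover have "((\<lambda>x. f x + c) has_field_derivative deriv f x) (at x)"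
    using assms(2)[of x] by (auto simp: DERIV_deriv_iff_field_differentiable[symmetric] intro!: derivative_eq_intros)
  ultimately show ?thesis
    using assms(1) by (simp add: DERIV_unique)
qed

text \<open>Links integrals over the circle with the absolute integrability in which the change of
  variables formula is phrased.\<close>

lemma
  fixes h :: "real \<Rightarrow> real"
  assumes B: "B \<in> sets lebesgue" "B \<subseteq> {0..<2 * pi}"
  shows integrable_circle_if_iff:
      "integrable circle (\<lambda>x. if x \<in> B then h x else 0) \<longleftrightarrow> h absolutely_integrable_on B"
    and integral_circle_if:
      "h absolutely_integrable_on B \<Longrightarrow> (LINT x|circle. (if x \<in> B then h x else 0)) = integral B h"
proof -
  have *: "(if x \<in> {0..<2 * pi} then if x \<in> B then h x else 0 else 0) = (if x \<in> B then h x else 0)" for x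
    using B(2) by auto
  show "integrable circle (\<lambda>x. if x \<in> B then h x else 0) \<longleftrightarrow> h absolutely_integrable_on B"
    using Lebesgue_Measure.integrable_restrict_UNIV[of "{0..<2 * pi}" "\<lambda>x. if x \<in> B then h x else 0"]
    unfolding * set_integrable_def indicator_scaleR_eq_if by simp
  show "(LINT x|circle. (if x \<in> B then h x else 0)) = integral B h" if "h absolutely_integrable_on B"
    using Lebesgue_Measure.integral_restrict_UNIV[of "{0..<2 * pi}" "\<lambda>x. if x \<in> B then h x else 0"]
      set_lebesgue_integral_eq_integral(2)[OF that]
    unfolding * set_lebesgue_integral_def indicator_scaleR_eq_if by simp
qed

section \<open>Lifts of expanding maps and their inverse branches\<close>

locale expanding_lift =
  fixes T :: "real \<Rightarrow> real" and T' :: "real \<Rightarrow> real" and d :: int and \<sigma> M :: real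
  assumes deriv: "(T has_real_derivative T' x) (at x)"
    and shift: "T (x + 2 * pi) = T x + 2 * pi * of_int d"
    and T'_periodic: "periodic T'"
    and \<sigma>: "1 < \<sigma>" "\<sigma> < \<bar>T' x\<bar>"
    and T'_lipschitz: "\<bar>T' x - T' y\<bar> \<le> M * \<bar>x - y\<bar>"
    and M: "0 < M"

lemma expanding_liftI:
  assumes "C4_circle_map T" "uniformly_expanding T"
  obtains d \<sigma> M where "expanding_lift T (deriv T) d \<sigma> M"
proof -
  obtain d :: int where d: "\<And>x. T (x + 2 * pi) = T x + 2 * pi * of_int d"
    using assms(1) by (auto simp: C4_circle_map_def)
  obtain \<sigma> where \<sigma>: "1 < \<sigma>" "\<And>x. \<sigma> < \<bar>deriv T x\<bar>"
    using assms(2) by (auto simp: uniformly_expanding_def)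
  have diff: "(deriv ^^ i) T differentiable_on UNIV" if "i < 4" for i
    using assms(1) that by (simp add: C4_circle_map_def C_k_def)
  then have fd: "(deriv ^^ i) T field_differentiable (at x)" if "i < 4" for i x
    using that by (simp add: differentiable_on_def field_differentiable_def real_differentiable_def)
  note fd0 = fd[of 0, simplified] and fd1 = fd[of 1, simplified]
  have p1: "deriv T (x + 2 * pi) = deriv T x" for x
    by (rule deriv_shift_eq[where c = "2 * pi * of_int d"]) (use d fd0 in auto)
  have p2: "deriv (deriv T) (x + 2 * pi) = deriv (deriv T) x" for x
    by (rule deriv_shift_eq[where c = 0]) (use p1 fd1 in auto)
  have "continuous_on UNIV (deriv (deriv T))"
    using differentiable_imp_continuous_on[OF diff[of 2]] by (simp add: numeral_2_eq_2)
  then obtain M where M: "0 \<le> M" "\<And>x. \<bar>deriv (deriv T) x\<bar> \<le> M"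
    using p2 by (auto simp: periodic_def elim: bounded_of_periodic)
  have lip: "\<bar>deriv T x - deriv T y\<bar> \<le> (M + 1) * \<bar>x - y\<bar>" for x y
  proof -
    have "norm (deriv T x - deriv T y) \<le> M * norm (x - y)"
      by (rule field_differentiable_bound[of UNIV "deriv T" "deriv (deriv T)"])
        (use fd1 M in \<open>auto simp: DERIV_deriv_iff_field_differentiable\<close>)
    also have "\<dots> \<le> (M + 1) * \<bar>x - y\<bar>"
      by (simp add: mult_right_mono)
    finally show ?thesis by simp
  qed
  \<comment> \<open>Adding 1 makes the constant strictly positive even if \<open>T\<close> has
    constant derivative; the cone parameter built from it must be positive.\<close>
  have "expanding_lift T (deriv T) d \<sigma> (M + 1)"
    by unfold_locales
      (use d \<sigma> M lip p1 fd0 in \<open>auto simp: DERIV_deriv_iff_field_differentiable periodic_def\<close>)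
  then show ?thesis by (rule that)
qed

context expanding_lift
begin

lemma shift_int: "T (x + 2 * pi * of_int k) = T x + 2 * pi * of_int (d * k)"
  using shift_by_int[of T "2 * pi" "2 * pi * of_int d" x k] shift by (simp add: mult_ac)

lemma T'_nonzero: "T' x \<noteq> 0"
  using \<sigma>(1) \<sigma>(2)[of x] by auto

lemma continuous_T: "continuous_on UNIV T"
  using deriv by (meson DERIV_isCont continuous_at_imp_continuous_on)

text \<open>The mean value theorem on the line. It makes the lift injective, although several points
  of the circle may share an image, and its inverse a contraction.\<close>

lemma expansion: "\<sigma> * \<bar>x - y\<bar> \<le> \<bar>T x - T y\<bar>"
proof -
  have *: "\<sigma> * \<bar>x - y\<bar> \<le> \<bar>T x - T y\<bar>" if xy: "x < y" for x y
  proof -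
    obtain z where "T y - T x = (y - x) * T' z"
      using MVT2[OF xy, of T T'] deriv by blast
    then have "\<bar>T x - T y\<bar> = \<bar>T' z\<bar> * \<bar>x - y\<bar>"
      by (metis abs_minus_commute abs_mult mult.commute)
    then show ?thesis
      using \<sigma>(2)[of z] by (simp add: mult_right_mono)
  qed
  show ?thesis
    using *[of x y] *[of y x] by (cases x y rule: linorder_cases) (auto simp: abs_minus_commute)
qed

lemma inj_T: "inj T"
proof (rule injI)
  fix x y assume "T x = T y"
  then show "x = y"
    using expansion[of x y] \<sigma>(1) by (simp add: mult_le_0_iff)
qed

lemma degree_nonzero: "d \<noteq> 0"
  using injD[OF inj_T, of "2 * pi" 0] shift[of 0] by auto

lemma surj_T: "surj T"
proof -
  have "\<exists>x. T x = y" for y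
  proof -
    obtain n :: nat where n: "\<bar>y\<bar> + \<bar>T 0\<bar> < real n"
      using reals_Archimedean2 by blast
    define D where "D = 2 * pi * \<bar>real_of_int d\<bar> * real n"
    have "1 \<le> 2 * pi * \<bar>real_of_int d\<bar>"
      using degree_nonzero mult_mono[of 1 "2 * pi" 1 "\<bar>real_of_int d\<bar>"] pi_gt3 by simp
    then have D: "\<bar>y\<bar> + \<bar>T 0\<bar> < D"
      using n mult_right_mono[of 1 _ "real n"] unfolding D_def by fastforce
    \<comment> \<open>The sign makes \<open>d * k = \<bar>d\<bar> * int n\<close>, so that
      \<open>T\<close> takes the values \<open>T 0 + D\<close> and \<open>T 0 - D\<close>, which
      enclose \<open>y\<close>.\<close>
    define k where "k = int n * sgn d"
    have k: "T (2 * pi * of_int k) = T 0 + D" "T (2 * pi * of_int (- k)) = T 0 - D"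
      using shift_int[of 0 k] shift_int[of 0 "- k"]
      by (auto simp: D_def k_def sgn_if algebra_simps abs_if)
    have conn: "connected (range T)"
      using continuous_T by (intro connected_continuous_image) auto
    have mem: "T 0 - D \<in> range T" "T 0 + D \<in> range T"
      by (auto simp flip: k)
    have "T 0 - D \<le> y" "y \<le> T 0 + D"
      using D by linarith+
    then have "y \<in> range T"
      by (rule connectedD_interval[OF conn mem])
    then show ?thesis by auto
  qed
  then show ?thesis
    by (auto simp: surj_def eq_commute)
qed

definition S :: "real \<Rightarrow> real" where
  "S = inv T"

lemma T_S [simp]: "T (S x) = x"
  by (simp add: S_def surj_T surj_f_inv_f)

lemma S_T [simp]: "S (T x) = x"
  by (simp add: S_def inj_T)

lemma S_eq_iff: "S x = y \<longleftrightarrow> T y = x"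
  by auto

lemma eq_S_iff: "y = S x \<longleftrightarrow> T y = x"
  by auto

lemma S_lipschitz: "\<bar>S x - S y\<bar> \<le> \<bar>x - y\<bar> / \<sigma>"
  using expansion[of "S x" "S y"] \<sigma>(1) by (simp add: field_simps)

lemma continuous_S: "continuous_on UNIV S"
proof (rule lipschitz_on_continuous_on)
  show "(1 / \<sigma>)-lipschitz_on UNIV S"
    using S_lipschitz \<sigma>(1) by (auto intro!: lipschitz_onI simp: dist_real_def)
qed

lemma deriv_S: "(S has_real_derivative 1 / T' (S x)) (at x within A)"
proof -
  have "(S has_real_derivative inverse (T' (S x))) (at x)"
    by (rule DERIV_inverse_function[where f = T and a = "x - 1" and b = "x + 1"])
      (use deriv T'_nonzero continuous_S in \<open>auto simp: continuous_on_eq_continuous_at\<close>)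
  then show ?thesis
    by (auto simp: inverse_eq_divide intro: has_field_derivative_at_within)
qed

lemma S_shift: "S (x + 2 * pi * of_int (d * k)) = S x + 2 * pi * of_int k"
  by (simp add: S_eq_iff shift_int del: of_int_mult)

text \<open>The index tells over which translate of \<open>x\<close> the lift is inverted. Indices
  congruent modulo \<open>d\<close> give the same point of the circle; this replaces a partition of
  the circle into monotonicity intervals.\<close>

definition branch :: "int \<Rightarrow> real \<Rightarrow> real" where
  "branch m x = S (x + 2 * pi * of_int m)"

lemma branch_shift: "branch (m + d * k) x = branch m x + 2 * pi * of_int k"
  using S_shift[of "x + 2 * pi * of_int m" k] by (simp add: branch_def algebra_simps)

lemma branch_inj:
  assumes "branch m x = branch n x"
  shows "m = n"
  using arg_cong[OF assms, of T] by (simp add: branch_def)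

lemma branch_eq_iff: "branch m x = y \<longleftrightarrow> T y = x + 2 * pi * of_int m"
  by (simp add: branch_def S_eq_iff)

lemma branch_lipschitz: "\<bar>branch m x - branch m y\<bar> \<le> \<bar>x - y\<bar> / \<sigma>"
  using S_lipschitz[of "x + 2 * pi * of_int m" "y + 2 * pi * of_int m"] by (simp add: branch_def)

lemma continuous_branch: "continuous_on UNIV (branch m)"
proof -
  have "continuous_on UNIV (S \<circ> (\<lambda>x. x + 2 * pi * of_int m))"
    by (intro continuous_on_compose continuous_intros continuous_on_subset[OF continuous_S]) auto
  then show ?thesis
    by (simp add: branch_def o_def cong: continuous_on_cong)
qed

lemma deriv_branch: "(branch m has_real_derivative 1 / T' (branch m x)) (at x within A)"
proof -
  have "(S has_real_derivative 1 / T' (branch m x)) (at (x + 2 * pi * of_int m))"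
    unfolding branch_def by (rule deriv_S)
  then have "((\<lambda>x. S (x + 2 * pi * of_int m)) has_real_derivative 1 / T' (branch m x)) (at x)"
    by (simp only: DERIV_shift)
  moreover have "branch m = (\<lambda>x. S (x + 2 * pi * of_int m))"
    by (simp add: branch_def fun_eq_iff)
  ultimately have "(branch m has_real_derivative 1 / T' (branch m x)) (at x)"
    by simp
  then show ?thesis
    by (rule has_field_derivative_at_within)
qed

lemma circle_preimage_eq: "circle_preimage T x = {0..<2 * pi} \<inter> range (\<lambda>m. branch m x)"
  unfolding circle_preimage_def branch_def by (auto simp: eq_S_iff)

text \<open>Wrapping changes the index by a multiple of \<open>d\<close>, and a branch value
  determines its index through \<open>T\<close>; so preimages on the circle correspond to
  residues.\<close>

lemma bij_betw_residues:
  "bij_betw (\<lambda>m. wrap (branch m x)) {0..<\<bar>d\<bar>} (circle_preimage T x)"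
proof (rule bij_betw_imageI)
  have wrapE: "\<exists>k. wrap (branch m x) = branch (m + d * k) x" for m
    unfolding branch_shift wrap_def by blast
  show "inj_on (\<lambda>m. wrap (branch m x)) {0..<\<bar>d\<bar>}"
  proof (rule inj_onI)
    fix m n assume mn: "m \<in> {0..<\<bar>d\<bar>}" "n \<in> {0..<\<bar>d\<bar>}" "wrap (branch m x) = wrap (branch n x)"
    obtain j k where "branch (m + d * j) x = branch (n + d * k) x"
      using wrapE[of m] wrapE[of n] mn(3) by metis
    then have "m + d * j = n + d * k"
      by (rule branch_inj)
    then have "m - n = d * (k - j)"
      by (simp add: algebra_simps)
    then have "m mod \<bar>d\<bar> = n mod \<bar>d\<bar>"
      by (simp add: mod_eq_dvd_iff)
    then show "m = n"
      using mn by simp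
  qed
  show "(\<lambda>m. wrap (branch m x)) ` {0..<\<bar>d\<bar>} = circle_preimage T x"
  proof (intro equalityI subsetI)
    fix y assume "y \<in> (\<lambda>m. wrap (branch m x)) ` {0..<\<bar>d\<bar>}"
    then show "y \<in> circle_preimage T x"
      unfolding circle_preimage_eq using wrap_range wrapE by fastforce
  next
    fix y assume "y \<in> circle_preimage T x"
    then obtain m where y: "y \<in> {0..<2 * pi}" "y = branch m x"
      by (auto simp: circle_preimage_eq)
    have "\<bar>d\<bar> dvd m - m mod \<bar>d\<bar>"
      by (simp add: minus_mod_eq_mult_div)
    then have "d dvd m - m mod \<bar>d\<bar>"
      by (simp only: abs_dvd_iff)
    then obtain k where k: "m - m mod \<bar>d\<bar> = d * k"
      unfolding dvd_def by blast
    have "m = m mod \<bar>d\<bar> + d * k" using k by simp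
    then have "y = branch (m mod \<bar>d\<bar>) x + 2 * pi * of_int k"
      using y(2) branch_shift by metis
    then have "y = wrap (branch (m mod \<bar>d\<bar>) x)"
      using wrap_id[OF y(1)] wrap_shift by metis
    moreover have "m mod \<bar>d\<bar> \<in> {0..<\<bar>d\<bar>}"
      using degree_nonzero by simp
    ultimately show "y \<in> (\<lambda>m. wrap (branch m x)) ` {0..<\<bar>d\<bar>}"
      by blast
  qed
qed

section \<open>The transfer operator on functions\<close>

definition transfer_fun :: "(real \<Rightarrow> real) \<Rightarrow> real \<Rightarrow> real" where
  "transfer_fun f x = (\<Sum>y\<in>circle_preimage T x. f y / \<bar>T' y\<bar>)"

text \<open>For periodic \<open>f\<close> the index set does not depend on \<open>x\<close> and no
  branch is cut off at the ends of the period, so the sums at two points can be compared term by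
  term.\<close>

lemma transfer_fun_periodic:
  assumes "periodic f"
  shows "transfer_fun f x = (\<Sum>m\<in>{0..<\<bar>d\<bar>}. f (branch m x) / \<bar>T' (branch m x)\<bar>)"
  unfolding transfer_fun_def sum.reindex_bij_betw[OF bij_betw_residues, symmetric]
  by (simp add: periodic_wrap assms T'_periodic)

text \<open>The counterpart for arbitrary representatives, whose values outside the fundamental
  domain carry no meaning: a branch counts only where it lands inside. Boundedness of
  \<open>T\<close> on one period confines the indices to a finite set independent of
  \<open>x\<close>.\<close>

lemma transfer_fun_branches:
  obtains N where "finite N"
    "\<And>x m. x \<in> {0..<2 * pi} \<Longrightarrow> branch m x \<in> {0..<2 * pi} \<Longrightarrow> m \<in> N"
    "\<And>f x. x \<in> {0..<2 * pi} \<Longrightarrow> transfer_fun f x =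
       (\<Sum>m\<in>N. if branch m x \<in> {0..<2 * pi} then f (branch m x) / \<bar>T' (branch m x)\<bar> else 0)"
proof -
  obtain B where B: "\<And>x. x \<in> {0..<2*pi} \<Longrightarrow> \<bar>T x\<bar> \<le> B"
    using bounded_on_circle[OF continuous_T] by blast
  define K where "K = \<lceil>B\<rceil> + 1"
  have K: "m \<in> {-K..K}" if "x \<in> {0..<2 * pi}" "branch m x \<in> {0..<2 * pi}" for x m
  proof -
    have "T (branch m x) = x + 2 * pi * of_int m"
      by (simp add: branch_def)
    then have "\<bar>2 * pi * real_of_int m\<bar> \<le> B + 2 * pi"
      using B[OF that(2)] that(1) unfolding abs_le_iff by auto
    then have "\<bar>real_of_int m\<bar> \<le> B / (2 * pi) + 1"
      by (simp add: abs_mult field_simps)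
    moreover have "0 \<le> B"
      using B[of 0] by simp
    then have "B / (2 * pi) \<le> B"
      using mult_left_mono[of 1 "2 * pi" B] pi_gt3 by (simp add: pos_divide_le_eq)
    ultimately have "\<bar>real_of_int m\<bar> \<le> of_int K"
      unfolding K_def by linarith
    then show ?thesis
      by simp linarith
  qed
  have "transfer_fun f x =
      (\<Sum>m\<in>{-K..K}. if branch m x \<in> {0..<2 * pi} then f (branch m x) / \<bar>T' (branch m x)\<bar> else 0)"
    if x: "x \<in> {0..<2 * pi}" for f x
  proof -
    have "circle_preimage T x = (\<lambda>m. branch m x) ` {m \<in> {-K..K}. branch m x \<in> {0..<2 * pi}}"
      using K[OF x] by (auto simp: circle_preimage_eq)
    moreover have "inj_on (\<lambda>m. branch m x) A" for A
      by (intro inj_onI) (rule branch_inj)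
    ultimately show ?thesis
      unfolding transfer_fun_def by (simp add: sum.reindex sum.inter_filter del: atLeastLessThan_iff atLeastAtMost_iff)
  qed
  with K show ?thesis
    by (intro that[of "{-K..K}"]) auto
qed

text \<open>The change of variables \<open>y = branch m x\<close> with Jacobian
  \<open>1 / \<bar>T' y\<bar>\<close>. The resulting integral runs over the points that
  \<open>T\<close> sends into one translate of the fundamental domain.\<close>

lemma has_bochner_integral_branch:
  assumes f: "integrable circle f"
  shows "has_bochner_integral circle
    (\<lambda>x. if branch m x \<in> {0..<2 * pi} then f (branch m x) / \<bar>T' (branch m x)\<bar> else 0)
    (LINT y|circle. (if T y - 2 * pi * of_int m \<in> {0..<2 * pi} then f y else 0))"
proof -
  define B where "B = {0..<2 * pi} \<inter> branch m -` {0..<2 * pi}"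
  define A where "A = {0..<2 * pi} \<inter> (\<lambda>y. T y - 2 * pi * of_int m) -` {0..<2 * pi}"
  have "branch m \<in> borel_measurable borel" "(\<lambda>y. T y - 2 * pi * of_int m) \<in> borel_measurable borel"
    by (intro borel_measurable_continuous_onI continuous_branch continuous_intros continuous_T)+
  then have "A \<in> sets borel" "B \<in> sets borel"
    unfolding A_def B_def by (auto simp: measurable_sets_borel)
  then have sets: "A \<in> sets lebesgue" "B \<in> sets lebesgue"
    by auto
  have sub: "A \<subseteq> {0..<2 * pi}" "B \<subseteq> {0..<2 * pi}"
    by (auto simp: A_def B_def)
  have image: "branch m ` B = A"
  proof (intro equalityI subsetI)
    fix y assume "y \<in> A"
    moreover have "y = branch m (T y - 2 * pi * of_int m)"
      by (simp add: branch_def)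
    ultimately show "y \<in> branch m ` B"
      by (auto simp: A_def B_def image_iff)
  qed (auto simp: A_def B_def branch_def)
  have inj: "inj_on (branch m) B"
    by (rule inj_onI) (metis branch_eq_iff add_right_cancel)
  have "f absolutely_integrable_on {0..<2 * pi}"
    using f by (subst integrable_circle_if_iff[symmetric])
      (auto elim: Bochner_Integration.integrable_cong[THEN iffD1, rotated 2])
  then have A: "f absolutely_integrable_on A"
    using set_integrable_subset sets(1) sub(1) by blast
  let ?h = "\<lambda>x. \<bar>1 / T' (branch m x)\<bar> * f (branch m x)"
  have "?h absolutely_integrable_on B \<and> integral B ?h = integral A f"
    using has_absolute_integral_change_of_variables_1'[OF sets(2) deriv_branch inj, of f] A image
    by simp
  then have "has_bochner_integral circle (\<lambda>x. if x \<in> B then ?h x else 0)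
      (LINT y|circle. (if y \<in> A then f y else 0))"
    using A sets sub by (simp add: has_bochner_integral_iff integrable_circle_if_iff integral_circle_if)
  moreover have "(LINT y|circle. (if y \<in> A then f y else 0)) =
      (LINT y|circle. (if T y - 2 * pi * of_int m \<in> {0..<2 * pi} then f y else 0))"
    by (intro Bochner_Integration.integral_cong) (auto simp: A_def)
  ultimately show ?thesis
    by (elim has_bochner_integral_cong[THEN iffD1, rotated 3]) (auto simp: B_def)
qed

text \<open>Each \<open>T y\<close> lies in exactly one translate of the fundamental domain, so the
  pieces produced by the branches reassemble the whole integral.\<close>

lemma
  assumes f: "integrable circle f"
  shows integrable_transfer_fun: "integrable circle (transfer_fun f)"
    and integral_transfer_fun: "(LINT x|circle. transfer_fun f x) = (LINT x|circle. f x)"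
proof -
  obtain N where N: "finite N"
    "\<And>x m. x \<in> {0..<2 * pi} \<Longrightarrow> branch m x \<in> {0..<2 * pi} \<Longrightarrow> m \<in> N"
    "\<And>f x. x \<in> {0..<2 * pi} \<Longrightarrow> transfer_fun f x =
       (\<Sum>m\<in>N. if branch m x \<in> {0..<2 * pi} then f (branch m x) / \<bar>T' (branch m x)\<bar> else 0)"
    using transfer_fun_branches by blast
  let ?I = "\<lambda>m y. if T y - 2 * pi * of_int m \<in> {0..<2 * pi} then f y else 0"
  have I: "integrable circle (?I m)" for m
  proof -
    define A where "A = (\<lambda>y. T y - 2 * pi * of_int m) -` {0..<2 * pi}"
    have "(\<lambda>y. T y - 2 * pi * of_int m) \<in> borel_measurable borel"
      by (intro borel_measurable_continuous_onI continuous_intros continuous_T)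
    then have "A \<in> sets borel"
      unfolding A_def by (auto simp: measurable_sets_borel)
    then have "indicator A \<in> borel_measurable circle"
      by (intro measurable_restrict_space1 borel_measurable_indicator) auto
    then have "integrable circle (\<lambda>y. f y * indicator A y)"
      by (rule integrable_mult_bounded_circle[OF f, where B = 1]) (auto simp: indicator_def)
    then show ?thesis
      by (rule Bochner_Integration.integrable_cong[THEN iffD1, rotated 2]) (auto simp: A_def)
  qed
  have sum_I: "(\<Sum>m\<in>N. ?I m y) = f y" if "y \<in> {0..<2 * pi}" for y
  proof -
    define n where "n = \<lfloor>T y / (2 * pi)\<rfloor>"
    have n: "T y - 2 * pi * of_int m \<in> {0..<2 * pi} \<longleftrightarrow> m = n" for m
      unfolding n_def floor_eq_iff[of _ m, THEN trans[OF eq_commute]] by (auto simp: field_simps)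
    have "branch n (T y - 2 * pi * of_int n) = y"
      by (simp add: branch_def)
    then have "n \<in> N"
      using N(2)[of "T y - 2 * pi * of_int n" n] n that by simp
    then show ?thesis
      using N(1) by (simp add: n del: atLeastLessThan_iff)
  qed
  have "has_bochner_integral circle
      (\<lambda>x. \<Sum>m\<in>N. if branch m x \<in> {0..<2 * pi} then f (branch m x) / \<bar>T' (branch m x)\<bar> else 0)
      (\<Sum>m\<in>N. LINT y|circle. ?I m y)"
    by (intro has_bochner_integral_sum has_bochner_integral_branch f)
  moreover have "(\<Sum>m\<in>N. LINT y|circle. ?I m y) = (LINT y|circle. (\<Sum>m\<in>N. ?I m y))"
    using I by (intro Bochner_Integration.integral_sum[symmetric])
  moreover have "\<dots> = (LINT y|circle. f y)"
    using sum_I by (intro Bochner_Integration.integral_cong) auto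
  ultimately have "has_bochner_integral circle (transfer_fun f) (LINT y|circle. f y)"
    by (elim has_bochner_integral_cong[THEN iffD1, rotated 3]) (auto simp: N(3))
  then show "integrable circle (transfer_fun f)" "(LINT x|circle. transfer_fun f x) = (LINT x|circle. f x)"
    by (auto simp: has_bochner_integral_iff)
qed

lemma transfer_fun_diff: "transfer_fun (\<lambda>x. f x - g x) x = transfer_fun f x - transfer_fun g x"
  by (simp add: transfer_fun_def diff_divide_distrib sum_subtractf)

lemma transfer_fun_add: "transfer_fun (\<lambda>x. f x + g x) x = transfer_fun f x + transfer_fun g x"
  by (simp add: transfer_fun_def add_divide_distrib sum.distrib)

lemma transfer_fun_mult: "transfer_fun (\<lambda>x. c * f x) x = c * transfer_fun f x"
  by (simp add: transfer_fun_def sum_distrib_left)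

lemma abs_transfer_fun_le: "\<bar>transfer_fun f x\<bar> \<le> transfer_fun (\<lambda>x. \<bar>f x\<bar>) x"
  unfolding transfer_fun_def by (rule order_trans[OF sum_abs]) simp

text \<open>Positivity moves the absolute value inside the operator, and conservation of mass does
  the rest.\<close>

lemma integral_abs_transfer_fun_le:
  assumes f: "integrable circle f"
  shows "(LINT x|circle. \<bar>transfer_fun f x\<bar>) \<le> (LINT x|circle. \<bar>f x\<bar>)"
proof -
  have "(LINT x|circle. \<bar>transfer_fun f x\<bar>) \<le> (LINT x|circle. transfer_fun (\<lambda>x. \<bar>f x\<bar>) x)"
    using f by (intro integral_mono abs_transfer_fun_le integrable_abs integrable_transfer_fun)
  then show ?thesis
    using f by (simp add: integral_transfer_fun)
qed

end

locale expanding_circle_map = expanding_lift T "deriv T" d \<sigma> M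
  for T :: "real \<Rightarrow> real" and d :: int and \<sigma> M :: real
begin

text \<open>The \<open>L\<^sup>1\<close> contraction bound applied to a difference of representatives shows that the
  choice made by \<^const>\<open>rep_L1\<close> is immaterial.\<close>

lemma transfer_operator_abs_L1:
  assumes f: "integrable circle f"
  shows "transfer_operator T (abs_L1 f) = abs_L1 (transfer_fun f)"
proof -
  define g where "g = rep_L1 (abs_L1 f)"
  have g: "integrable circle g" "AE x in circle. g x = f x"
    using integrable_rep_L1 rep_abs_L1_AE[OF f] by (auto simp: g_def)
  have int: "integrable circle (\<lambda>x. \<bar>transfer_fun (\<lambda>x. g x - f x) x\<bar>)"
    using f g by (intro integrable_abs integrable_transfer_fun) auto
  have "(LINT x|circle. \<bar>transfer_fun (\<lambda>x. g x - f x) x\<bar>) \<le> (LINT x|circle. \<bar>g x - f x\<bar>)"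
    using f g by (intro integral_abs_transfer_fun_le) auto
  also have "\<dots> = (LINT x|circle. 0)"
    using f g by (intro integral_cong_AE) auto
  finally have "(LINT x|circle. \<bar>transfer_fun (\<lambda>x. g x - f x) x\<bar>) = 0"
    by (simp add: integral_nonneg_AE order_antisym)
  then have "AE x in circle. transfer_fun (\<lambda>x. g x - f x) x = 0"
    using int by (subst (asm) integral_nonneg_eq_0_iff_AE) auto
  then have "AE x in circle. transfer_fun g x = transfer_fun f x"
    by (simp add: transfer_fun_diff)
  moreover have "transfer_operator T (abs_L1 f) = abs_L1 (transfer_fun g)"
    by (simp add: transfer_operator_def transfer_fun_def[abs_def] g_def)
  ultimately show ?thesis
    using f g by (auto intro!: abs_L1_eqI integrable_transfer_fun)
qed

lemma norm_transfer_operator_le: "norm (transfer_operator T F) \<le> norm F"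
proof -
  obtain f where f: "integrable circle f" "F = abs_L1 f" by (rule L1_cases)
  then show ?thesis
    by (simp add: transfer_operator_abs_L1 norm_abs_L1 integral_abs_transfer_fun_le integrable_transfer_fun)
qed

lemma linear_transfer_operator: "linear (transfer_operator T)"
proof (rule linearI)
  fix F G c
  obtain f where f: "integrable circle f" "F = abs_L1 f" by (rule L1_cases)
  obtain g where g: "integrable circle g" "G = abs_L1 g" by (rule L1_cases)
  show "transfer_operator T (F + G) = transfer_operator T F + transfer_operator T G"
    using f g
    by (simp add: transfer_operator_abs_L1 plus_abs_L1 integrable_transfer_fun transfer_fun_add[abs_def])
  show "transfer_operator T (c *\<^sub>R F) = c *\<^sub>R transfer_operator T F"
    using f
    by (simp add: transfer_operator_abs_L1 scaleR_abs_L1 integrable_transfer_fun transfer_fun_mult[abs_def])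
qed

end

section \<open>Exponential decay\<close>

text \<open>Where \<open>f\<close> is positive, the last condition says that \<open>ln f\<close> is
  Lipschitz with constant \<open>a\<close>; the exponential form avoids logarithms and admits the
  zero function.\<close>

definition cone :: "real \<Rightarrow> (real \<Rightarrow> real) \<Rightarrow> bool" where
  "cone a f \<longleftrightarrow> periodic f \<and> (\<forall>x. 0 \<le> f x) \<and> (\<forall>x y. f x \<le> exp (a * \<bar>x - y\<bar>) * f y)"

lemma coneD:
  assumes "cone a f"
  shows "periodic f" "0 \<le> f x" "f x \<le> exp (a * \<bar>x - y\<bar>) * f y"
  using assms by (auto simp: cone_def)

lemma cone_continuous:
  assumes f: "cone a f"
  shows "continuous_on UNIV f"
proof -
  have "(f \<longlongrightarrow> f x) (at x)" for x
  proof (rule tendsto_sandwich)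
    have "exp (- (a * \<bar>x - y\<bar>)) * f x \<le> f y" for y
      using coneD(3)[OF f, of x y] by (simp add: exp_minus field_simps)
    then show "\<forall>\<^sub>F y in at x. exp (- (a * \<bar>x - y\<bar>)) * f x \<le> f y"
      by simp
    show "\<forall>\<^sub>F y in at x. f y \<le> exp (a * \<bar>y - x\<bar>) * f x"
      using coneD(3)[OF f] by simp
    have "((\<lambda>y. exp (- (a * \<bar>x - y\<bar>)) * f x) \<longlongrightarrow> exp (- (a * \<bar>x - x\<bar>)) * f x) (at x)"
      by (intro tendsto_intros)
    then show "((\<lambda>y. exp (- (a * \<bar>x - y\<bar>)) * f x) \<longlongrightarrow> f x) (at x)"
      by simp
    have "((\<lambda>y. exp (a * \<bar>y - x\<bar>) * f x) \<longlongrightarrow> exp (a * \<bar>x - x\<bar>) * f x) (at x)"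
      by (intro tendsto_intros)
    then show "((\<lambda>y. exp (a * \<bar>y - x\<bar>) * f x) \<longlongrightarrow> f x) (at x)"
      by simp
  qed
  then show ?thesis
    by (simp add: continuous_on_eq_continuous_at isCont_def)
qed

lemma cone_integrable: "cone a f \<Longrightarrow> integrable circle f"
  by (intro integrable_continuous_circle cone_continuous)

lemma cone_mono:
  assumes "cone a f" "a \<le> b"
  shows "cone b f"
proof -
  have "exp (a * \<bar>x - y\<bar>) * f y \<le> exp (b * \<bar>x - y\<bar>) * f y" for x y
    using assms(2) coneD(2)[OF assms(1)] by (intro mult_right_mono) (auto intro: mult_right_mono)
  then show ?thesis
    using assms(1) unfolding cone_def by (meson order_trans)
qed

lemma cone_scale: "cone a f \<Longrightarrow> 0 \<le> k \<Longrightarrow> cone a (\<lambda>x. k * f x)"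
  by (auto simp: cone_def periodic_def mult.left_commute intro!: mult_left_mono)

lemma abs_diff_le_circle: "x \<in> {0..<2 * pi} \<Longrightarrow> y \<in> {0..<2 * pi} \<Longrightarrow> \<bar>x - y\<bar> \<le> 2 * pi"
  by (auto simp: abs_le_iff)

text \<open>A Harnack inequality: within one period values differ by a factor of at most
  \<open>exp (2 * pi * a)\<close>. Integrating over \<open>x\<close> compares \<open>f y\<close>
  with the total mass 1.\<close>

lemma cone_lower_bound:
  assumes f: "cone a f" "(LINT x|circle. f x) = 1" and a: "0 \<le> a"
  shows "exp (- 2 * pi * a) / (2 * pi) \<le> f y"
proof -
  have *: "exp (- 2 * pi * a) / (2 * pi) \<le> f y" if y: "y \<in> {0..<2 * pi}" for y
  proof -
    have le: "f x \<le> exp (2 * pi * a) * f y" if x: "x \<in> {0..<2 * pi}" for x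
    proof -
      have "a * \<bar>x - y\<bar> \<le> 2 * pi * a"
        using mult_left_mono[OF abs_diff_le_circle[OF x y] a] by (simp add: mult_ac)
      then show ?thesis
        using coneD(2,3)[OF f(1)] by (meson exp_le_cancel_iff mult_right_mono order_trans)
    qed
    have "(LINT x|circle. f x) \<le> (LINT x|circle. exp (2 * pi * a) * f y)"
      using le by (intro integral_mono cone_integrable[OF f(1)]) auto
    then have "1 \<le> 2 * pi * (exp (2 * pi * a) * f y)"
      unfolding f(2) LINT_const_circle .
    then show ?thesis
      by (simp add: exp_minus field_simps)
  qed
  show ?thesis
    using *[OF wrap_range, of y] periodic_wrap[OF coneD(1)[OF f(1)], of y] by simp
qed

text \<open>Convexity of the exponential gives \<open>exp (a' t) \<le> (a' / a) exp (a t) + (1 - a' / a)\<close>.\<close>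

lemma cone_subtract_const:
  assumes f: "cone a' f" and a: "0 < a'" "a' < a" and c: "\<And>y. c \<le> (1 - a' / a) * f y"
  shows "cone a (\<lambda>x. f x - c)"
  unfolding cone_def
proof (intro conjI allI)
  show "periodic (\<lambda>x. f x - c)"
    using coneD(1)[OF f] by (simp add: periodic_def)
  show "0 \<le> f x - c" for x
  proof -
    have "(1 - a' / a) * f x \<le> 1 * f x"
      using a coneD(2)[OF f] by (intro mult_right_mono) auto
    then show ?thesis using c[of x] by simp
  qed
  show "f x - c \<le> exp (a * \<bar>x - y\<bar>) * (f y - c)" for x y
  proof -
    define t where "t = \<bar>x - y\<bar>"
    have t: "0 \<le> t" by (simp add: t_def)
    define \<kappa> where "\<kappa> = 1 - a' / a"
    have \<kappa>: "0 \<le> \<kappa>" "\<kappa> \<le> 1" "a' * t = \<kappa> * 0 + (1 - \<kappa>) * (a * t)"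
      using a by (auto simp: \<kappa>_def)
    have "exp (a' * t) \<le> \<kappa> * exp 0 + (1 - \<kappa>) * exp (a * t)"
      unfolding \<kappa>(3) using convex_onD[OF exp_convex, of "1 - \<kappa>" 0 "a * t"] \<kappa> by simp
    then have "exp (a' * t) * f y \<le> (\<kappa> * exp 0 + (1 - \<kappa>) * exp (a * t)) * f y"
      using coneD(2)[OF f] by (intro mult_right_mono) auto
    moreover have "f x \<le> exp (a' * t) * f y"
      using coneD(3)[OF f] by (simp add: t_def)
    \<comment> \<open>This product is exactly \<open>exp (a * t) * (f y - c)\<close> minus the upper
      bound for \<open>f x - c\<close> that convexity yields.\<close>
    moreover have "0 \<le> (\<kappa> * f y - c) * (exp (a * t) - 1)"
      using c[of y] a t by (intro mult_nonneg_nonneg) (auto simp: \<kappa>_def)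
    ultimately show ?thesis
      by (simp add: t_def algebra_simps)
  qed
qed

text \<open>The slope of \<open>f\<close> relative to its value is at most \<open>a\<close>, and
  \<open>1 + t \<le> exp t\<close> turns this additive control into the multiplicative one of the
  cone.\<close>

lemma lipschitz_shift_in_cone:
  assumes f: "periodic f" and lip: "\<And>x y. \<bar>f x - f y\<bar> \<le> K * \<bar>x - y\<bar>"
    and lower: "\<And>x. K \<le> a * f x" and a: "0 < a" and K: "0 < K"
  shows "cone a f"
  unfolding cone_def
proof (intro conjI allI f)
  have pos: "0 < f x" for x
    using lower[of x] a K by (metis less_le_trans zero_less_mult_pos)
  then show "0 \<le> f x" for x
    by (simp add: less_imp_le)
  fix x y
  have "f x \<le> f y + K * \<bar>x - y\<bar>"
    using lip[of x y] by linarith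
  also have "\<dots> \<le> f y + (a * f y) * \<bar>x - y\<bar>"
    using lower by (intro add_left_mono mult_right_mono) auto
  also have "\<dots> = (1 + a * \<bar>x - y\<bar>) * f y"
    by (simp add: algebra_simps)
  also have "\<dots> \<le> exp (a * \<bar>x - y\<bar>) * f y"
    using pos by (intro mult_right_mono exp_ge_add_one_self) (simp add: less_imp_le)
  finally show "f x \<le> exp (a * \<bar>x - y\<bar>) * f y" .
qed

text \<open>With mean zero, \<open>f x\<close> is the average over \<open>y\<close> of
  \<open>f x - f y\<close>.\<close>

lemma zero_mean_lipschitz_bound:
  assumes f: "periodic f" and lip: "\<And>x y. \<bar>f x - f y\<bar> \<le> K * \<bar>x - y\<bar>"
    and int: "integrable circle f" "(LINT x|circle. f x) = 0"
  shows "\<bar>f x\<bar> \<le> 2 * pi * K"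
proof -
  have *: "\<bar>f x\<bar> \<le> 2 * pi * K" if x: "x \<in> {0..<2 * pi}" for x
  proof -
    have K: "0 \<le> K"
      using lip[of 1 0] by simp
    have le: "\<bar>f x - f y\<bar> \<le> 2 * pi * K" if y: "y \<in> {0..<2 * pi}" for y
      using lip[of x y] mult_left_mono[OF abs_diff_le_circle[OF x y] K] by (simp add: mult_ac)
    have "2 * pi * \<bar>f x\<bar> = \<bar>LINT y|circle. f x - f y\<bar>"
      using int by (simp add: abs_mult)
    also have "\<dots> \<le> (LINT y|circle. \<bar>f x - f y\<bar>)"
      by (rule integral_abs_bound)
    also have "\<dots> \<le> (LINT y|circle. 2 * pi * K)"
      using le int by (intro integral_mono) auto
    also have "\<dots> = 2 * pi * (2 * pi * K)"
      by (rule LINT_const_circle)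
    finally show ?thesis
      by (rule mult_left_le_imp_le) simp
  qed
  show ?thesis
    using *[OF wrap_range, of x] periodic_wrap[OF f] by simp
qed

lemma linear_funpow: "linear f \<Longrightarrow> linear (f ^^ n)" for f :: "'a::real_vector \<Rightarrow> 'a"
  by (induction n) (auto intro: linear_compose simp: id_def[symmetric] linear_id)

section \<open>Action of the transfer operator on cones\<close>

context expanding_lift
begin

lemma transfer_fun_shift: "transfer_fun f (x + 2 * pi) = transfer_fun f x"
proof -
  have "(\<exists>m. T y = x + 2 * pi + 2 * pi * of_int m) \<longleftrightarrow> (\<exists>m. T y = x + 2 * pi * of_int m)" for y
  proof
    assume "\<exists>m. T y = x + 2 * pi + 2 * pi * of_int m"
    then obtain m where "T y = x + 2 * pi * of_int (m + 1)"
      by (auto simp: algebra_simps)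
    then show "\<exists>m. T y = x + 2 * pi * of_int m" ..
  next
    assume "\<exists>m. T y = x + 2 * pi * of_int m"
    then obtain m where "T y = x + 2 * pi + 2 * pi * of_int (m - 1)"
      by (auto simp: algebra_simps)
    then show "\<exists>m. T y = x + 2 * pi + 2 * pi * of_int m" ..
  qed
  then show ?thesis
    by (simp add: transfer_fun_def circle_preimage_def)
qed

text \<open>The additive bound \<open>M * \<bar>x - y\<bar>\<close> becomes a relative one because
  the derivative exceeds 1 in modulus.\<close>

lemma distortion: "1 / \<bar>T' x\<bar> \<le> exp (M * \<bar>x - y\<bar>) / \<bar>T' y\<bar>"
proof -
  have "\<bar>T' y\<bar> \<le> \<bar>T' x\<bar> + M * \<bar>x - y\<bar>"
    using T'_lipschitz[of x y] by linarith
  also have "M * \<bar>x - y\<bar> \<le> \<bar>T' x\<bar> * (M * \<bar>x - y\<bar>)"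
    using mult_right_mono[of 1 "\<bar>T' x\<bar>" "M * \<bar>x - y\<bar>"] \<sigma>(1) \<sigma>(2)[of x] M by simp
  also have "\<bar>T' x\<bar> + \<bar>T' x\<bar> * (M * \<bar>x - y\<bar>) = \<bar>T' x\<bar> * (1 + M * \<bar>x - y\<bar>)"
    by (simp add: algebra_simps)
  also have "\<dots> \<le> \<bar>T' x\<bar> * exp (M * \<bar>x - y\<bar>)"
    by (intro mult_left_mono exp_ge_add_one_self) simp
  finally show ?thesis
    using T'_nonzero[of x] T'_nonzero[of y] by (simp add: field_simps)
qed

text \<open>A branch shortens distances by the factor \<open>1 / \<sigma>\<close>, so the values of
  \<open>f\<close> contribute \<open>a / \<sigma>\<close> to the exponent and the weights, by
  distortion, \<open>M / \<sigma>\<close>. The estimate holds for each branch and survives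
  summation.\<close>

lemma cone_transfer_fun:
  assumes f: "cone a f" and a: "0 \<le> a"
  shows "cone ((a + M) / \<sigma>) (transfer_fun f)"
  unfolding cone_def
proof (intro conjI allI)
  show "periodic (transfer_fun f)"
    by (simp add: periodic_def transfer_fun_shift)
  show "0 \<le> transfer_fun f x" for x
    unfolding transfer_fun_def using coneD(2)[OF f] by (intro sum_nonneg) auto
  fix x y
  have "f (branch m x) / \<bar>T' (branch m x)\<bar>
      \<le> exp ((a + M) / \<sigma> * \<bar>x - y\<bar>) * (f (branch m y) / \<bar>T' (branch m y)\<bar>)" for m
  proof -
    define s where "s = \<bar>branch m x - branch m y\<bar>"
    have s: "s \<le> \<bar>x - y\<bar> / \<sigma>"
      using branch_lipschitz by (simp add: s_def)
    have "f (branch m x) * (1 / \<bar>T' (branch m x)\<bar>)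
        \<le> (exp (a * s) * f (branch m y)) * (exp (M * s) / \<bar>T' (branch m y)\<bar>)"
      unfolding s_def using coneD(2)[OF f] by (intro mult_mono coneD(3)[OF f] distortion) auto
    also have "\<dots> = exp ((a + M) * s) * (f (branch m y) / \<bar>T' (branch m y)\<bar>)"
      by (simp add: distrib_right exp_add)
    also have "(a + M) * s \<le> (a + M) / \<sigma> * \<bar>x - y\<bar>"
      using mult_left_mono[OF s, of "a + M"] a M by simp
    then have "exp ((a + M) * s) * (f (branch m y) / \<bar>T' (branch m y)\<bar>)
        \<le> exp ((a + M) / \<sigma> * \<bar>x - y\<bar>) * (f (branch m y) / \<bar>T' (branch m y)\<bar>)"
      using coneD(2)[OF f] by (intro mult_right_mono) auto
    finally show ?thesis by simp
  qed
  then show "transfer_fun f x \<le> exp ((a + M) / \<sigma> * \<bar>x - y\<bar>) * transfer_fun f y"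
    unfolding transfer_fun_periodic[OF coneD(1)[OF f]] sum_distrib_left by (rule sum_mono)
qed

end

section \<open>Coupling of two densities of the cone\<close>

context expanding_circle_map
begin

text \<open>With \<open>a = 2 M / (\<sigma> - 1)\<close> the transfer operator maps the cone of parameter \<open>a\<close> into the one of
  parameter \<open>(a + M) / \<sigma> < a\<close>; this leaves room for splitting off the constant density with
  weight \<open>coupling\<close>.\<close>

definition a\<^sub>0 :: real where
  "a\<^sub>0 = 2 * M / (\<sigma> - 1)"

definition coupling :: real where
  "coupling = (1 - (a\<^sub>0 + M) / \<sigma> / a\<^sub>0) * exp (- 2 * pi * a\<^sub>0)"

definition cone_densities :: "L1 set" where
  "cone_densities = {abs_L1 f |f. cone a\<^sub>0 f \<and> (LINT x|circle. f x) = 1}"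

lemma a\<^sub>0_pos: "0 < a\<^sub>0"
  using \<sigma>(1) M by (simp add: a\<^sub>0_def)

text \<open>The map sending \<open>a\<close> to \<open>(a + M) / \<sigma>\<close> has the fixed
  point \<open>M / (\<sigma> - 1)\<close>; at twice that value it strictly decreases the
  parameter.\<close>

lemma a\<^sub>0_contracts: "0 < (a\<^sub>0 + M) / \<sigma>" "(a\<^sub>0 + M) / \<sigma> < a\<^sub>0"
proof -
  show "0 < (a\<^sub>0 + M) / \<sigma>"
    using a\<^sub>0_pos \<sigma>(1) M by simp
  have "a\<^sub>0 * (\<sigma> - 1) = 2 * M"
    using \<sigma>(1) by (simp add: a\<^sub>0_def)
  then have "a\<^sub>0 + M < a\<^sub>0 * \<sigma>"
    using M by (simp add: algebra_simps)
  then show "(a\<^sub>0 + M) / \<sigma> < a\<^sub>0"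
    using \<sigma>(1) by (simp add: pos_divide_less_eq)
qed

lemma a\<^sub>0_ratio: "0 < (a\<^sub>0 + M) / \<sigma> / a\<^sub>0" "(a\<^sub>0 + M) / \<sigma> / a\<^sub>0 < 1"
  using divide_pos_pos[OF a\<^sub>0_contracts(1) a\<^sub>0_pos] divide_less_eq_1_pos[OF a\<^sub>0_pos] a\<^sub>0_contracts(2)
  by blast+

lemma coupling_bounds: "0 < coupling" "coupling < 1"
proof -
  have *: "0 < 1 - (a\<^sub>0 + M) / \<sigma> / a\<^sub>0" "1 - (a\<^sub>0 + M) / \<sigma> / a\<^sub>0 < 1"
    using a\<^sub>0_ratio by (simp_all only: diff_gt_0_iff_gt diff_less_eq less_add_same_cancel1)
  then show "0 < coupling"
    by (simp add: coupling_def)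
  have "coupling \<le> (1 - (a\<^sub>0 + M) / \<sigma> / a\<^sub>0) * 1"
    unfolding coupling_def using * a\<^sub>0_pos by (intro mult_left_mono) auto
  then show "coupling < 1"
    using * by simp
qed

lemma norm_cone_density: "F \<in> cone_densities \<Longrightarrow> norm F = 1"
  using coneD(2) by (auto simp: cone_densities_def norm_abs_L1 cone_integrable cong: Bochner_Integration.integral_cong)

text \<open>The minorisation step. Once mass \<open>coupling\<close> is removed, the remainder is
  rescaled to a density of the same cone, which is what permits iteration.\<close>

lemma cone_density_split:
  assumes "F \<in> cone_densities"
  obtains F' where "F' \<in> cone_densities"
    "transfer_operator T F = abs_L1 (\<lambda>_. coupling / (2 * pi)) + (1 - coupling) *\<^sub>R F'"
proof -
  obtain f where f: "cone a\<^sub>0 f" "(LINT x|circle. f x) = 1" "F = abs_L1 f"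
    using assms by (auto simp: cone_densities_def)
  define g where "g = transfer_fun f"
  \<comment> \<open>The room between the two cones times the least value granted by
    \<open>cone_lower_bound\<close>: a constant that \<open>cone_subtract_const\<close> accepts,
    with integral \<open>coupling\<close> over the circle.\<close>
  define c where "c = coupling / (2 * pi)"
  have g: "cone ((a\<^sub>0 + M) / \<sigma>) g" "(LINT x|circle. g x) = 1"
    using cone_transfer_fun[OF f(1)] a\<^sub>0_pos f(2) integral_transfer_fun[OF cone_integrable[OF f(1)]]
    by (auto simp: g_def)
  note g' = cone_mono[OF g(1) less_imp_le[OF a\<^sub>0_contracts(2)]]
  have "c \<le> (1 - (a\<^sub>0 + M) / \<sigma> / a\<^sub>0) * g y" for y
  proof -
    have "c = (1 - (a\<^sub>0 + M) / \<sigma> / a\<^sub>0) * (exp (- 2 * pi * a\<^sub>0) / (2 * pi))"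
      by (simp add: c_def coupling_def)
    also have "\<dots> \<le> (1 - (a\<^sub>0 + M) / \<sigma> / a\<^sub>0) * g y"
      using cone_lower_bound[OF g' g(2) less_imp_le[OF a\<^sub>0_pos]] a\<^sub>0_ratio(2)
      by (intro mult_left_mono) (simp_all only: diff_ge_0_iff_ge less_imp_le)
    finally show ?thesis .
  qed
  then have cone: "cone a\<^sub>0 (\<lambda>x. g x - c)"
    using cone_subtract_const[OF g(1) a\<^sub>0_contracts] by blast
  define h where "h = (\<lambda>x. 1 / (1 - coupling) * (g x - c))"
  have h: "cone a\<^sub>0 h"
    unfolding h_def using coupling_bounds by (intro cone_scale cone) auto
  have "(LINT x|circle. h x) = 1"
    unfolding h_def using g(2) cone_integrable[OF g'] coupling_bounds by (simp add: c_def)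
  then have "abs_L1 h \<in> cone_densities"
    using h by (auto simp: cone_densities_def)
  moreover have "abs_L1 (\<lambda>_. c) + (1 - coupling) *\<^sub>R abs_L1 h = abs_L1 g"
    using cone_integrable[OF h] coupling_bounds
    by (simp add: scaleR_abs_L1 plus_abs_L1) (simp add: h_def)
  then have "transfer_operator T F = abs_L1 (\<lambda>_. c) + (1 - coupling) *\<^sub>R abs_L1 h"
    using f cone_integrable by (simp add: transfer_operator_abs_L1 g_def)
  ultimately show ?thesis
    using that by (simp add: c_def)
qed

text \<open>Both images contain the same constant part, which cancels in the difference and leaves
  the factor \<open>1 - coupling\<close>. The remainders are new densities, hence the induction over
  arbitrary pairs.\<close>

lemma cone_densities_decay:
  assumes "F \<in> cone_densities" "G \<in> cone_densities"
  shows "norm ((transfer_operator T ^^ n) (F - G)) \<le> 2 * (1 - coupling) ^ n"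
  using assms
proof (induction n arbitrary: F G)
  case 0
  then show ?case
    using norm_triangle_ineq4[of F G] by (simp add: norm_cone_density)
next
  case (Suc n)
  let ?L = "transfer_operator T"
  obtain F' where F': "F' \<in> cone_densities"
    "?L F = abs_L1 (\<lambda>_. coupling / (2 * pi)) + (1 - coupling) *\<^sub>R F'"
    using cone_density_split[OF Suc.prems(1)] by blast
  obtain G' where G': "G' \<in> cone_densities"
    "?L G = abs_L1 (\<lambda>_. coupling / (2 * pi)) + (1 - coupling) *\<^sub>R G'"
    using cone_density_split[OF Suc.prems(2)] by blast
  have "(?L ^^ Suc n) (F - G) = (?L ^^ n) (?L F - ?L G)"
    by (simp add: funpow_Suc_right linear_diff[OF linear_transfer_operator] del: funpow.simps)
  also have "\<dots> = (1 - coupling) *\<^sub>R (?L ^^ n) (F' - G')"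
    unfolding F'(2) G'(2)
    by (simp flip: linear_scale[OF linear_funpow[OF linear_transfer_operator]] add: scaleR_diff_right)
  finally have "norm ((?L ^^ Suc n) (F - G)) = (1 - coupling) * norm ((?L ^^ n) (F' - G'))"
    using coupling_bounds by simp
  also have "\<dots> \<le> (1 - coupling) * (2 * (1 - coupling) ^ n)"
    using coupling_bounds Suc.IH[OF F'(1) G'(1)] by (intro mult_left_mono) auto
  finally show ?case
    by simp
qed

text \<open>Up to the factor \<open>2 * pi * B\<close>, \<open>f\<close> is the difference of two
  densities of the cone: the normalised \<open>f + B\<close> and the uniform density. Beyond
  \<open>K\<close>, nothing about \<open>f\<close> enters the bound.\<close>

lemma exponential_decay:
  fixes K :: real
  assumes f: "periodic f" and lip: "\<And>x y. \<bar>f x - f y\<bar> \<le> K * \<bar>x - y\<bar>" and K: "0 < K"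
    and int: "integrable circle f" "(LINT x|circle. f x) = 0"
  shows "norm ((transfer_operator T ^^ n) (abs_L1 f))
    \<le> 4 * pi * (2 * pi + 1 / a\<^sub>0) * K * (1 - coupling) ^ n"
proof -
  \<comment> \<open>The part \<open>2 * pi * K\<close> compensates the most negative value of
    \<open>f\<close>; the extra \<open>K / a\<^sub>0\<close> is what
    \<open>lipschitz_shift_in_cone\<close> demands.\<close>
  define B where "B = (2 * pi + 1 / a\<^sub>0) * K"
  have B: "0 < B"
    using a\<^sub>0_pos K by (simp add: B_def add_pos_pos)
  have lower: "K \<le> a\<^sub>0 * (f x + B)" for x
  proof -
    have "K / a\<^sub>0 \<le> f x + B"
      using zero_mean_lipschitz_bound[OF f lip int, of x] by (simp add: B_def algebra_simps abs_le_iff)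
    then show ?thesis
      using a\<^sub>0_pos by (simp add: field_simps)
  qed
  define g where "g = (\<lambda>x. 1 / (2 * pi * B) * (f x + B))"
  have "cone a\<^sub>0 (\<lambda>x. f x + B)"
    using f lip lower a\<^sub>0_pos K
    by (intro lipschitz_shift_in_cone[where K = K]) (auto simp: periodic_def)
  then have "cone a\<^sub>0 g"
    unfolding g_def using B by (intro cone_scale) auto
  moreover have g: "integrable circle g" "(LINT x|circle. g x) = 1"
    using int B by (simp_all add: g_def)
  ultimately have 1: "abs_L1 g \<in> cone_densities"
    by (auto simp: cone_densities_def)
  have "cone a\<^sub>0 (\<lambda>_. 1 / (2 * pi))"
    using a\<^sub>0_pos by (simp add: cone_def periodic_def divide_right_mono)
  then have 2: "abs_L1 (\<lambda>_. 1 / (2 * pi)) \<in> cone_densities"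
    by (force simp: cone_densities_def)
  have "2 * pi * B * (g x - 1 / (2 * pi)) = f x" for x
    using B by (simp add: g_def field_simps)
  then have "abs_L1 f = (2 * pi * B) *\<^sub>R (abs_L1 g - abs_L1 (\<lambda>_. 1 / (2 * pi)))"
    using g by (simp add: minus_abs_L1 scaleR_abs_L1)
  then have "(transfer_operator T ^^ n) (abs_L1 f)
      = (2 * pi * B) *\<^sub>R (transfer_operator T ^^ n) (abs_L1 g - abs_L1 (\<lambda>_. 1 / (2 * pi)))"
    by (simp add: linear_scale[OF linear_funpow[OF linear_transfer_operator]])
  then have "norm ((transfer_operator T ^^ n) (abs_L1 f))
      = 2 * pi * B * norm ((transfer_operator T ^^ n) (abs_L1 g - abs_L1 (\<lambda>_. 1 / (2 * pi))))"
    using B by simp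
  also have "\<dots> \<le> 2 * pi * B * (2 * (1 - coupling) ^ n)"
    using cone_densities_decay[OF 1 2] B by (intro mult_left_mono) auto
  also have "\<dots> = 4 * pi * B * (1 - coupling) ^ n"
    by simp
  finally show ?thesis
    by (simp only: B_def mult.assoc)
qed

end

section \<open>Trigonometric polynomials\<close>

text \<open>Passage to the closed interval, on which the fundamental theorem is applied; only the
  null set of the endpoint is added.\<close>

lemma LINT_circle_eq_integral:
  fixes f :: "real \<Rightarrow> real"
  assumes "integrable circle f"
  shows "(LINT x|circle. f x) = integral {0..2 * pi} f" "f integrable_on {0..2 * pi}"
    "f absolutely_integrable_on {0..2 * pi}"
proof -
  have abs: "f absolutely_integrable_on {0..<2 * pi}"
    using assms by (subst integrable_circle_if_iff[symmetric])
      (auto elim: Bochner_Integration.integrable_cong[THEN iffD1, rotated 2])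
  have neg: "negligible {x \<in> {0..<2 * pi} - {0..2 * pi}. h x \<noteq> 0}"
      "negligible {x \<in> {0..2 * pi} - {0..<2 * pi}. h x \<noteq> 0}" for h :: "real \<Rightarrow> real"
    by (rule negligible_subset[of "{2 * pi}"]; force)+
  have "(f has_integral (LINT x|circle. f x)) {0..<2 * pi}"
    by (rule has_integral_integral_lebesgue_on) (use assms in auto)
  then have *: "(f has_integral (LINT x|circle. f x)) {0..2 * pi}"
    using has_integral_spike_set_eq[OF neg] by blast
  then show "(LINT x|circle. f x) = integral {0..2 * pi} f" "f integrable_on {0..2 * pi}"
    by (auto simp: integral_unique)
  show "f absolutely_integrable_on {0..2 * pi}"
    by (rule absolutely_integrable_spike_set[OF abs neg])
qed

text \<open>Real polynomials in the real and imaginary parts of \<open>cis x\<close> are the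
  trigonometric polynomials. In the linear case the chain rule gives
  \<open>f (\<i> * cis x)\<close>; being closed under differentiation, the class consists of smooth
  functions.\<close>

lemma real_polynomial_cis_deriv:
  fixes p :: "complex \<Rightarrow> real"
  assumes "real_polynomial_function p"
  shows "\<exists>p'. real_polynomial_function p' \<and>
    (\<forall>x. ((\<lambda>x. p (cis x)) has_real_derivative p' (cis x)) (at x))"
  using assms
proof induction
  case (linear f)
  have "((\<lambda>x. f (cis x)) has_real_derivative f (\<i> * cis x)) (at x)" for x
  proof -
    have "(cis has_derivative (\<lambda>t. t *\<^sub>R (\<i> * cis x))) (at x)"
      using has_derivative_cis[of "\<lambda>x. x" "\<lambda>t. t"] by simp
    then show ?thesis
      using bounded_linear.has_derivative[OF linear] linear
      by (fastforce simp: has_field_derivative_def linear_cmul bounded_linear.linear mult.commute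
          elim: has_derivative_eq_rhs)
  qed
  moreover have "bounded_linear (\<lambda>z. f (\<i> * z))"
    using bounded_linear_compose[OF linear bounded_linear_mult_right] by simp
  ultimately show ?case
    by (intro exI[of _ "\<lambda>z. f (\<i> * z)"]) auto
next
  case (const c)
  show ?case
    by (intro exI[of _ "\<lambda>_. 0"]) auto
next
  case (add f g)
  then obtain f' g' where "real_polynomial_function f'" "real_polynomial_function g'"
    "\<And>x. ((\<lambda>x. f (cis x)) has_real_derivative f' (cis x)) (at x)"
    "\<And>x. ((\<lambda>x. g (cis x)) has_real_derivative g' (cis x)) (at x)"
    by blast
  then show ?case
    by (intro exI[of _ "\<lambda>z. f' z + g' z"]) (auto intro: DERIV_add)
next
  case (mult f g)
  then obtain f' g' where "real_polynomial_function f'" "real_polynomial_function g'"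
    "\<And>x. ((\<lambda>x. f (cis x)) has_real_derivative f' (cis x)) (at x)"
    "\<And>x. ((\<lambda>x. g (cis x)) has_real_derivative g' (cis x)) (at x)"
    by blast
  then show ?case
    using mult.hyps
    by (intro exI[of _ "\<lambda>z. f' z * g z + g' z * f z"]) (auto intro: DERIV_mult)
qed

lemma iterated_deriv_trig:
  assumes "real_polynomial_function p"
  shows "\<exists>p'. real_polynomial_function p' \<and> (deriv ^^ k) (\<lambda>x. p (cis x)) = (\<lambda>x. p' (cis x))"
proof (induction k)
  case 0
  then show ?case using assms by auto
next
  case (Suc k)
  then obtain q where q: "real_polynomial_function q" "(deriv ^^ k) (\<lambda>x. p (cis x)) = (\<lambda>x. q (cis x))"
    by blast
  obtain q' where "real_polynomial_function q'"
    "\<And>x. ((\<lambda>x. q (cis x)) has_real_derivative q' (cis x)) (at x)"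
    using real_polynomial_cis_deriv[OF q(1)] by blast
  then show ?case
    using q(2) by (auto intro!: exI[of _ q'] DERIV_imp_deriv)
qed

lemma trig_differentiable:
  assumes "real_polynomial_function p"
  shows "(\<lambda>x. p (cis x)) differentiable_on UNIV"
  using real_polynomial_cis_deriv[OF assms]
  by (auto simp: differentiable_on_def real_differentiable_def)

lemma trig_continuous: "real_polynomial_function p \<Longrightarrow> continuous_on UNIV (\<lambda>x. p (cis x))"
  by (intro differentiable_imp_continuous_on trig_differentiable)

lemma trig_periodic: "periodic (\<lambda>x. p (cis x))"
  by (simp add: periodic_def cis.ctr)

lemma trig_test_function:
  assumes "real_polynomial_function p"
  shows "test_function (\<lambda>x. p (cis x))"
  unfolding test_function_def C_k_def
  using iterated_deriv_trig[OF assms] trig_differentiable trig_continuous trig_periodic[of p]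
  by (auto simp: periodic_def) metis+

lemma trig_lipschitz:
  assumes "real_polynomial_function p"
  obtains K where "0 < K" "\<And>x y. \<bar>p (cis x) - p (cis y)\<bar> \<le> K * \<bar>x - y\<bar>"
proof -
  obtain p' where p': "real_polynomial_function p'"
    "\<And>x. ((\<lambda>x. p (cis x)) has_real_derivative p' (cis x)) (at x)"
    using real_polynomial_cis_deriv[OF assms] by blast
  obtain K where K: "0 \<le> K" "\<And>x. \<bar>p' (cis x)\<bar> \<le> K"
    using bounded_of_periodic[OF trig_continuous[OF p'(1)] trig_periodic] by blast
  have "\<bar>p (cis x) - p (cis y)\<bar> \<le> (K + 1) * \<bar>x - y\<bar>" for x y
  proof -
    have "norm (p (cis x) - p (cis y)) \<le> K * norm (x - y)"
      by (rule field_differentiable_bound[of UNIV _ "\<lambda>x. p' (cis x)"]) (use p' K in auto)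
    also have "\<dots> \<le> (K + 1) * norm (x - y)"
      by (simp add: mult_right_mono)
    finally show ?thesis by simp
  qed
  then show ?thesis
    using K(1) by (intro that[of "K + 1"]) auto
qed

text \<open>The parametrisation of the circle by a compact interval is a quotient map.\<close>

lemma continuous_on_circle_quotient:
  fixes w :: "real \<Rightarrow> real"
  assumes w: "continuous_on {0..2 * pi} w" and F: "\<And>x. x \<in> {0..2 * pi} \<Longrightarrow> F (cis x) = w x"
  shows "continuous_on (sphere 0 1) F"
proof -
  have cont_cis: "continuous_on S cis" for S
    by (intro continuous_intros)
  have "closed (F -` C \<inter> sphere 0 1)" if C: "closed C" for C
  proof -
    have "F -` C \<inter> sphere 0 1 = cis ` ({0..2 * pi} \<inter> w -` C)"
    proof (intro equalityI subsetI)
      fix z assume z: "z \<in> F -` C \<inter> sphere 0 1"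
      then obtain x where "0 \<le> x" "x < 2 * pi" "z = cis x"
        using complex_unimodular_polar[of z] by (auto simp: cis.ctr)
      then show "z \<in> cis ` ({0..2 * pi} \<inter> w -` C)"
        using z F[of x] by auto
    qed (use F in auto)
    moreover have "compact ({0..2 * pi} \<inter> w -` C)"
      by (simp add: compact_eq_bounded_closed bounded_Int continuous_closed_preimage[OF w _ C])
    then have "compact (cis ` ({0..2 * pi} \<inter> w -` C))"
      by (intro compact_continuous_image cont_cis)
    ultimately show ?thesis
      using compact_imp_closed by simp
  qed
  then show ?thesis
    by (subst continuous_on_closed_vimage) auto
qed

text \<open>Stone-Weierstrass on the unit circle. Equality of the endpoint values lets
  \<open>w\<close> descend to the circle.\<close>

lemma trig_uniform_approx:
  fixes w :: "real \<Rightarrow> real"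
  assumes w: "continuous_on {0..2 * pi} w" "w 0 = w (2 * pi)" and "0 < e"
  obtains p where "real_polynomial_function p" "\<And>x. x \<in> {0..2 * pi} \<Longrightarrow> \<bar>w x - p (cis x)\<bar> < e"
proof -
  define F where "F z = w (Arg2pi z)" for z
  have F: "F (cis x) = w x" if "x \<in> {0..2 * pi}" for x
  proof (cases "x = 2 * pi")
    case True
    then show ?thesis using w(2) Arg2pi_of_real[of 1] by (simp add: F_def)
  next
    case False
    then have "Arg2pi (cis x) = x"
      using that by (intro Arg2pi_unique[of 1]) (auto simp: cis_conv_exp)
    then show ?thesis by (simp add: F_def)
  qed
  obtain p where p: "real_polynomial_function p" "\<And>z. z \<in> sphere 0 1 \<Longrightarrow> \<bar>F z - p z\<bar> < e"
    using Stone_Weierstrass_real_polynomial_function[OF compact_sphere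
        continuous_on_circle_quotient[OF w(1) F] \<open>0 < e\<close>] by blast
  have "\<bar>w x - p (cis x)\<bar> < e" if "x \<in> {0..2 * pi}" for x
    using p(2)[of "cis x"] F[OF that] by simp
  with p(1) show ?thesis
    by (rule that)
qed

text \<open>A measurable function is almost everywhere a limit of continuous ones; these are
  clipped, made to agree at both ends, and approximated uniformly. The bound 2 is there for
  dominated convergence.\<close>

lemma trig_bounded_AE_approx:
  fixes f :: "real \<Rightarrow> real"
  assumes f: "f \<in> borel_measurable circle" "\<And>x. \<bar>f x\<bar> \<le> 1"
  obtains p where "\<And>n. real_polynomial_function (p n)" "\<And>n x. \<bar>p n (cis x)\<bar> \<le> 2"
    "AE x in circle. (\<lambda>n. p n (cis x)) \<longlonglongrightarrow> f x"
proof -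
  have "(\<lambda>x. if x \<in> {0..<2 * pi} then f x else 0) \<in> borel_measurable lebesgue"
    using f(1) by (subst borel_measurable_if) auto
  then have "(\<lambda>x. if x \<in> {0..<2 * pi} then f x else 0) measurable_on UNIV"
    by (rule lebesgue_measurable_imp_measurable_on_real) simp
  then obtain N g where N: "negligible N" and g: "\<And>n. continuous_on UNIV (g n)"
    and lim: "\<And>x. x \<notin> N \<Longrightarrow> (\<lambda>n. g n x) \<longlonglongrightarrow> (if x \<in> {0..<2 * pi} then f x else 0)"
    unfolding measurable_on_def by force
  \<comment> \<open>The first factor vanishes at both ends of the period and tends to 1 inside; the
    second clips to the range of \<open>f\<close> and so keeps the limit.\<close>
  define v where "v n x = min 1 (real n * (x * (2 * pi - x))) * max (-1) (min 1 (g n x))" for n x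
  have "continuous_on {0..2 * pi} (v n)" for n
    unfolding v_def by (intro continuous_intros continuous_on_subset[OF g]) auto
  moreover have "v n 0 = v n (2 * pi)" for n
    by (simp add: v_def)
  ultimately have "\<exists>p. real_polynomial_function p \<and>
      (\<forall>x \<in> {0..2 * pi}. \<bar>v n x - p (cis x)\<bar> < 1 / real (Suc n))" for n
    using trig_uniform_approx[of "v n" "1 / real (Suc n)"] by (metis of_nat_0_less_iff zero_less_Suc zero_less_divide_1_iff)
  then obtain p where p: "\<And>n. real_polynomial_function (p n)"
    "\<And>n x. x \<in> {0..2 * pi} \<Longrightarrow> \<bar>v n x - p n (cis x)\<bar> < 1 / real (Suc n)"
    by metis
  have v_le: "\<bar>v n x\<bar> \<le> 1" if "x \<in> {0..2 * pi}" for n x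
  proof -
    have "\<bar>v n x\<bar> \<le> 1 * 1"
      unfolding v_def abs_mult using that by (intro mult_mono) auto
    then show ?thesis by simp
  qed
  have bound: "\<bar>p n (cis x)\<bar> \<le> 2" for n x
  proof -
    have x: "wrap x \<in> {0..2 * pi}"
      using wrap_range[of x] by auto
    have "1 / real (Suc n) \<le> 1"
      by simp
    then have "\<bar>p n (cis (wrap x))\<bar> \<le> 2"
      using v_le[OF x, of n] p(2)[OF x, of n] by linarith
    then show ?thesis
      using periodic_wrap[OF trig_periodic] by metis
  qed
  have conv: "(\<lambda>n. p n (cis x)) \<longlonglongrightarrow> f x" if x: "x \<notin> N" "0 < x" "x < 2 * pi" for x
  proof -
    define c where "c = x * (2 * pi - x)"
    have c: "0 < c"
      using x by (simp add: c_def)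
    obtain k where k: "1 / c < real k"
      using reals_Archimedean2 by blast
    have "(\<lambda>n. min 1 (real n * c)) \<longlonglongrightarrow> 1"
    proof (rule tendsto_eventually, rule eventually_sequentiallyI)
      fix n assume "k \<le> n"
      then have "1 / c \<le> real n"
        using k by linarith
      then show "min 1 (real n * c) = 1"
        using c by (simp add: field_simps)
    qed
    moreover have "(\<lambda>n. max (-1) (min 1 (g n x))) \<longlonglongrightarrow> max (-1) (min 1 (f x))"
      using lim[OF x(1)] x by (intro tendsto_intros) simp
    ultimately have "(\<lambda>n. v n x) \<longlonglongrightarrow> 1 * max (-1) (min 1 (f x))"
      unfolding v_def c_def by (rule tendsto_mult)
    moreover have "max (-1) (min 1 (f x)) = f x"
      using f(2)[of x] by (simp add: abs_le_iff)
    ultimately have v: "(\<lambda>n. v n x) \<longlonglongrightarrow> f x"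
      by simp
    have "(\<lambda>n. v n x - p n (cis x)) \<longlonglongrightarrow> 0"
      by (rule Lim_null_comparison[OF _ LIMSEQ_inverse_real_of_nat])
        (use p(2)[of x] x in \<open>auto simp: inverse_eq_divide less_imp_le\<close>)
    from tendsto_diff[OF v this] show ?thesis
      by simp
  qed
  \<comment> \<open>At 0 the cut-off forces \<open>v\<close> to vanish, so this point joins the
    exceptional set.\<close>
  have "AE x in lebesgue. x \<notin> insert 0 N"
    using N by (intro AE_not_in) (simp add: negligible_iff_null_sets)
  then have "AE x in lebesgue. x \<in> {0..<2 * pi} \<longrightarrow> (\<lambda>n. p n (cis x)) \<longlonglongrightarrow> f x"
    by eventually_elim (use conv in auto)
  then have "AE x in circle. (\<lambda>n. p n (cis x)) \<longlonglongrightarrow> f x"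
    by (simp add: AE_restrict_space_iff)
  with p(1) bound show ?thesis
    by (rule that)
qed

lemma trig_measurable [measurable]:
  "real_polynomial_function p \<Longrightarrow> (\<lambda>x. p (cis x)) \<in> borel_measurable circle"
  by (intro continuous_on_measurable_circle trig_continuous)

text \<open>Bounded approximations of \<open>sgn (f x)\<close> serve as test functions, and their
  vanishing integrals converge to that of \<open>\<bar>f x\<bar>\<close>.\<close>

lemma zero_AE_of_test:
  assumes f: "integrable circle f"
    and test: "\<And>p. real_polynomial_function p \<Longrightarrow> (LINT x|circle. f x * p (cis x)) = 0"
  shows "AE x in circle. f x = 0"
proof -
  have [measurable]: "f \<in> borel_measurable circle"
    using f by simp
  have "(\<lambda>x. sgn (f x)) \<in> borel_measurable circle"
    by measurable
  moreover have "\<bar>sgn (f x)\<bar> \<le> 1" for x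
    by (simp add: abs_sgn_eq)
  ultimately obtain p where p: "\<And>n. real_polynomial_function (p n)" "\<And>n x. \<bar>p n (cis x)\<bar> \<le> 2"
    "AE x in circle. (\<lambda>n. p n (cis x)) \<longlonglongrightarrow> sgn (f x)"
    by (rule trig_bounded_AE_approx) blast
  have "(\<lambda>n. LINT x|circle. f x * p n (cis x)) \<longlonglongrightarrow> (LINT x|circle. f x * sgn (f x))"
  proof (rule integral_dominated_convergence[where w = "\<lambda>x. 2 * \<bar>f x\<bar>"])
    show "AE x in circle. (\<lambda>n. f x * p n (cis x)) \<longlonglongrightarrow> f x * sgn (f x)"
      using p(3) by eventually_elim (intro tendsto_intros)
    show "AE x in circle. norm (f x * p n (cis x)) \<le> 2 * \<bar>f x\<bar>" for n
      using mult_left_mono[OF p(2) abs_ge_zero] by (intro AE_I2) (simp add: abs_mult mult.commute)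
  qed (use f p(1) in auto)
  then have "(LINT x|circle. \<bar>f x\<bar>) = 0"
    using test p(1) by (simp add: LIMSEQ_const_iff abs_sgn mult.commute)
  then show ?thesis
    using f by (subst (asm) integral_nonneg_eq_0_iff_AE) auto
qed

text \<open>Truncation reduces to bounded functions, and division by the truncation level to
  functions bounded by 1. Each of the two dominated limits takes half of \<open>e\<close>.\<close>

lemma trig_L1_dense:
  fixes f :: "real \<Rightarrow> real"
  assumes f: "integrable circle f" and e: "0 < e"
  obtains p where "real_polynomial_function p" "(LINT x|circle. \<bar>f x - p (cis x)\<bar>) < e"
proof -
  have [measurable]: "f \<in> borel_measurable circle"
    using f by simp
  \<comment> \<open>\<open>Suc k\<close> keeps the truncation level positive; it is divided by
    below.\<close>
  define t where "t k x = max (- real (Suc k)) (min (real (Suc k)) (f x))" for k x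
  have [measurable]: "t k \<in> borel_measurable circle" for k
    unfolding t_def by measurable
  have "(\<lambda>k. LINT x|circle. \<bar>f x - t k x\<bar>) \<longlonglongrightarrow> (LINT x|circle. 0)"
  proof (rule integral_dominated_convergence[where w = "\<lambda>x. \<bar>f x\<bar>"])
    have "(\<lambda>k. \<bar>f x - t k x\<bar>) \<longlonglongrightarrow> 0" for x
    proof -
      obtain j where j: "\<bar>f x\<bar> < real j"
        using reals_Archimedean2 by blast
      show ?thesis
        by (rule tendsto_eventually, rule eventually_sequentiallyI[of j]) (use j in \<open>auto simp: t_def\<close>)
    qed
    then show "AE x in circle. (\<lambda>k. \<bar>f x - t k x\<bar>) \<longlonglongrightarrow> 0"
      by simp
    show "AE x in circle. norm \<bar>f x - t k x\<bar> \<le> \<bar>f x\<bar>" for k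
      by (rule AE_I2) (auto simp: t_def)
  qed (use f in auto)
  then have "\<forall>\<^sub>F k in sequentially. (LINT x|circle. \<bar>f x - t k x\<bar>) < e / 2"
    using e by (intro order_tendstoD) auto
  then obtain k where k: "(LINT x|circle. \<bar>f x - t k x\<bar>) < e / 2"
    by (auto simp: eventually_sequentially)
  define N where "N = real (Suc k)"
  have N: "0 < N" by (simp add: N_def)
  have tN: "\<bar>t k x\<bar> \<le> N" for x
    by (auto simp: t_def N_def)
  obtain p where p: "\<And>n. real_polynomial_function (p n)" "\<And>n x. \<bar>p n (cis x)\<bar> \<le> 2"
    "AE x in circle. (\<lambda>n. p n (cis x)) \<longlonglongrightarrow> t k x / N"
    using trig_bounded_AE_approx[of "\<lambda>x. t k x / N"] tN N by auto
  have "(\<lambda>n. LINT x|circle. \<bar>t k x - N * p n (cis x)\<bar>) \<longlonglongrightarrow> (LINT x|circle. 0)"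
  proof (rule integral_dominated_convergence[where w = "\<lambda>x. N + N * 2"])
    show "AE x in circle. (\<lambda>n. \<bar>t k x - N * p n (cis x)\<bar>) \<longlonglongrightarrow> 0"
      using p(3)
    proof eventually_elim
      fix x assume "(\<lambda>n. p n (cis x)) \<longlonglongrightarrow> t k x / N"
      then have "(\<lambda>n. \<bar>t k x - N * p n (cis x)\<bar>) \<longlonglongrightarrow> \<bar>t k x - N * (t k x / N)\<bar>"
        by (intro tendsto_intros)
      then show "(\<lambda>n. \<bar>t k x - N * p n (cis x)\<bar>) \<longlonglongrightarrow> 0"
        using N by simp
    qed
    have "\<bar>N * p n (cis x)\<bar> \<le> N * 2" for n x
      unfolding abs_mult using p(2) N by (intro mult_mono) auto
    then show "AE x in circle. norm \<bar>t k x - N * p n (cis x)\<bar> \<le> N + N * 2" for n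
      using tN by (intro AE_I2) (smt (verit) real_norm_def)
  qed (use p(1) in auto)
  then have "\<forall>\<^sub>F n in sequentially. (LINT x|circle. \<bar>t k x - N * p n (cis x)\<bar>) < e / 2"
    using e by (intro order_tendstoD) auto
  then obtain n where n: "(LINT x|circle. \<bar>t k x - N * p n (cis x)\<bar>) < e / 2"
    by (auto simp: eventually_sequentially)
  have int: "integrable circle (t k)" "integrable circle (\<lambda>x. N * p n (cis x))"
    using integrable_bounded_circle[of "t k" N] tN p(1)
    by (auto intro!: integrable_continuous_circle continuous_intros trig_continuous)
  have "(LINT x|circle. \<bar>f x - N * p n (cis x)\<bar>)
      \<le> (LINT x|circle. \<bar>f x - t k x\<bar> + \<bar>t k x - N * p n (cis x)\<bar>)"
    using f int by (intro integral_mono) auto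
  also have "\<dots> < e"
    using f int k n by simp
  finally show ?thesis
    using p(1) by (intro that[of "\<lambda>z. N * p n z"]) auto
qed

section \<open>Weak derivatives\<close>

text \<open>Trigonometric polynomials are test functions and separate the elements of
  \<open>L1\<close>. This gives the \<open>THE\<close> in \<open>sobolev_norm\<close> its
  meaning.\<close>

lemma weak_deriv_unique:
  assumes "has_weak_deriv k F G" "has_weak_deriv k F H"
  shows "G = H"
proof -
  obtain g where g: "integrable circle g" "G = abs_L1 g" by (rule L1_cases)
  obtain h where h: "integrable circle h" "H = abs_L1 h" by (rule L1_cases)
  obtain f where f: "integrable circle f" "F = abs_L1 f" by (rule L1_cases)
  have "(LINT x|circle. (g x - h x) * p (cis x)) = 0" if p: "real_polynomial_function p" for p
  proof -
    have "(- 1) ^ k * (LINT x|circle. g x * p (cis x)) = (- 1) ^ k * (LINT x|circle. h x * p (cis x))"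
      using assms f g h trig_test_function[OF p] by (simp add: has_weak_deriv_abs_L1)
    then have "(LINT x|circle. g x * p (cis x)) = (LINT x|circle. h x * p (cis x))"
      by simp
    then show ?thesis
      using g h trig_continuous[OF p] by (simp add: left_diff_distrib integrable_mult_continuous_circle)
  qed
  then have "AE x in circle. g x - h x = 0"
    using g h by (intro zero_AE_of_test) auto
  then show ?thesis
    using g h by (auto intro: abs_L1_eqI)
qed

lemma norm_weak_deriv_le_sobolev_norm:
  assumes "has_weak_deriv i F G" "i \<le> k"
  shows "norm G \<le> sobolev_norm k F"
proof -
  have "(THE g. has_weak_deriv i F g) = G"
    using assms(1) weak_deriv_unique by blast
  then have "norm G = norm (THE g. has_weak_deriv i F g)"
    by simp
  also have "\<dots> \<le> sobolev_norm k F"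
    unfolding sobolev_norm_def using assms(2) by (intro member_le_sum) auto
  finally show ?thesis .
qed

text \<open>Used on one closed period; for integrable \<open>g\<close> it closes up around the
  circle exactly when \<open>g\<close> has mean zero.\<close>

definition primitive :: "(real \<Rightarrow> real) \<Rightarrow> real \<Rightarrow> real" where
  "primitive g x = integral {0..x} g"

context
  fixes g :: "real \<Rightarrow> real"
  assumes g: "integrable circle g"
begin

lemma integrable_on_initial:
  assumes "x \<in> {0..2 * pi}"
  shows "g absolutely_integrable_on {0..x}" "g integrable_on {0..x}"
proof -
  show "g absolutely_integrable_on {0..x}"
    using assms by (intro set_integrable_subset[OF LINT_circle_eq_integral(3)[OF g]]) auto
  then show "g integrable_on {0..x}"
    by (rule set_lebesgue_integral_eq_integral)
qed

lemma primitive_0: "primitive g 0 = 0"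
  by (simp add: primitive_def)

lemma primitive_2pi: "primitive g (2 * pi) = (LINT x|circle. g x)"
  using LINT_circle_eq_integral(1)[OF g] by (simp add: primitive_def)

lemma abs_primitive_le:
  assumes x: "x \<in> {0..2 * pi}"
  shows "\<bar>primitive g x\<bar> \<le> (LINT y|circle. \<bar>g y\<bar>)"
proof -
  have abs: "(\<lambda>y. \<bar>g y\<bar>) integrable_on {0..2 * pi}"
    using LINT_circle_eq_integral(2)[of "\<lambda>y. \<bar>g y\<bar>"] g by simp
  have "norm (integral {0..x} g) \<le> integral {0..x} (\<lambda>y. \<bar>g y\<bar>)"
    using integrable_on_initial[OF x] abs_absolutely_integrableI_1
    by (intro integral_norm_bound_integral) (auto simp: absolutely_integrable_on_def)
  also have "\<dots> \<le> integral {0..2 * pi} (\<lambda>y. \<bar>g y\<bar>)"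
    using x abs integrable_on_initial[OF x]
    by (intro integral_subset_le) (auto simp: absolutely_integrable_on_def)
  also have "\<dots> = (LINT y|circle. \<bar>g y\<bar>)"
    using LINT_circle_eq_integral(1)[of "\<lambda>y. \<bar>g y\<bar>"] g by simp
  finally show ?thesis
    by (simp add: primitive_def)
qed

lemma continuous_on_primitive: "continuous_on {0..2 * pi} (primitive g)"
  unfolding primitive_def[abs_def]
  by (rule indefinite_integral_continuous_1) (rule LINT_circle_eq_integral(2)[OF g])

lemma measurable_primitive: "primitive g \<in> borel_measurable circle"
  by (intro continuous_imp_measurable_on_sets_lebesgue continuous_on_subset[OF continuous_on_primitive])
    auto

lemma integrable_primitive_mult:
  assumes "continuous_on UNIV v"
  shows "integrable circle (\<lambda>x. primitive g x * v x)"
proof -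
  have "integrable circle (\<lambda>x. v x * primitive g x)"
    using assms abs_primitive_le
    by (intro integrable_mult_bounded_circle[where B = "LINT y|circle. \<bar>g y\<bar>"]
        measurable_primitive integrable_continuous_circle) auto
  then show ?thesis
    by (simp add: mult.commute)
qed

lemma integrable_primitive: "integrable circle (primitive g)"
  using integrable_primitive_mult[of "\<lambda>_. 1"] by simp

lemma primitive_increment_le:
  assumes xy: "x \<in> {0..2 * pi}" "y \<in> {0..2 * pi}" and bound: "\<And>x. \<bar>g x\<bar> \<le> B"
  shows "\<bar>primitive g x - primitive g y\<bar> \<le> B * \<bar>x - y\<bar>"
proof -
  have *: "\<bar>primitive g y - primitive g x\<bar> \<le> B * (y - x)" if "0 \<le> x" "x \<le> y" "y \<le> 2 * pi" for x y
  proof -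
    have "integral {0..x} g + integral {x..y} g = integral {0..y} g"
      using that integrable_on_initial[of y] by (intro Henstock_Kurzweil_Integration.integral_combine) auto
    then have "primitive g y - primitive g x = integral {x..y} g"
      by (simp add: primitive_def)
    moreover have "g integrable_on {x..y}"
      using integrable_on_initial(2)[of y] that by (auto intro: integrable_on_subinterval)
    then have "norm (integral {x..y} g) \<le> integral {x..y} (\<lambda>_. B)"
      using bound by (intro integral_norm_bound_integral) auto
    ultimately show ?thesis
      using that by (simp add: mult.commute)
  qed
  show ?thesis
    using *[of x y] *[of y x] xy by (cases "x \<le> y") (auto simp: abs_minus_commute)
qed

end

lemma primitive_diff:
  assumes "integrable circle f" "integrable circle g" "x \<in> {0..2 * pi}"
  shows "primitive (\<lambda>x. f x - g x) x = primitive f x - primitive g x"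
  unfolding primitive_def using assms integrable_on_initial
  by (intro Henstock_Kurzweil_Integration.integral_diff) auto

section \<open>Integration by parts and functions with a given weak derivative\<close>

lemma test_function_deriv:
  assumes "test_function u"
  shows "(u has_real_derivative deriv u x) (at x)"
proof -
  have "C_k 1 u"
    using assms by (simp add: test_function_def)
  then have "u differentiable_on UNIV"
    by (simp add: C_k_def)
  then show ?thesis
    by (simp add: differentiable_on_def DERIV_deriv_iff_real_differentiable)
qed

lemma test_function_deriv_test:
  assumes u: "test_function u"
  shows "test_function (deriv u)"
proof -
  have C: "C_k (Suc k) u" for k
    using u by (simp add: test_function_def)
  have "C_k k (deriv u)" for k
    using C[of k] unfolding C_k_def
    by (metis Suc_less_eq funpow_Suc_right o_apply)
  moreover have "deriv u (x + 2 * pi) = deriv u x" for x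
    by (rule deriv_shift_eq[where c = 0])
      (use u test_function_deriv[OF u] in \<open>auto simp: test_function_def field_differentiable_def\<close>)
  ultimately show ?thesis
    by (simp add: test_function_def)
qed

lemma trig_integrable: "real_polynomial_function p \<Longrightarrow> integrable circle (\<lambda>x. p (cis x))"
  by (intro integrable_continuous_circle trig_continuous)

text \<open>A boundary term remains because \<open>u\<close> is periodic while the primitive gains
  the integral of \<open>g\<close> over a period.\<close>

lemma by_parts_trig:
  assumes q: "real_polynomial_function q" and u: "test_function u"
  defines "g \<equiv> \<lambda>x. q (cis x)"
  shows "(LINT x|circle. primitive g x * deriv u x) =
    u 0 * (LINT x|circle. g x) - (LINT x|circle. g x * u x)"
proof -
  note cont = test_function_continuous[OF u, of 0, simplified] test_function_continuous[OF u, of 1, simplified]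
  have g: "integrable circle g" "continuous_on UNIV g"
    using q by (simp_all add: g_def trig_integrable trig_continuous)
  have "((\<lambda>x. primitive g x * u x) has_vector_derivative g x * u x + primitive g x * deriv u x)
      (at x within {0..2 * pi})" if x: "x \<in> {0..2 * pi}" for x
  proof -
    have "(primitive g has_real_derivative g x) (at x within {0..2 * pi})"
      unfolding primitive_def[abs_def]
      by (rule integral_has_real_derivative) (use x g in \<open>auto intro: continuous_on_subset\<close>)
    moreover have "(u has_real_derivative deriv u x) (at x within {0..2 * pi})"
      using test_function_deriv[OF u] has_field_derivative_at_within by blast
    ultimately have "((\<lambda>x. primitive g x * u x) has_real_derivative g x * u x + deriv u x * primitive g x)
        (at x within {0..2 * pi})"
      by (rule DERIV_mult)
    then show ?thesis
      by (simp add: has_real_derivative_iff_has_vector_derivative mult.commute)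
  qed
  then have "((\<lambda>x. g x * u x + primitive g x * deriv u x) has_integral
      primitive g (2 * pi) * u (2 * pi) - primitive g 0 * u 0) {0..2 * pi}"
    by (intro fundamental_theorem_of_calculus) auto
  moreover have "u (2 * pi) = u 0"
    using u by (auto simp: test_function_def dest: spec[of _ 0])
  ultimately have "integral {0..2 * pi} (\<lambda>x. g x * u x + primitive g x * deriv u x) =
      u 0 * (LINT x|circle. g x)"
    using primitive_2pi[OF g(1)] primitive_0[OF g(1)] by (simp add: integral_unique)
  moreover have int: "integrable circle (\<lambda>x. g x * u x)" "integrable circle (\<lambda>x. primitive g x * deriv u x)"
    using g cont by (auto intro: integrable_mult_continuous_circle integrable_primitive_mult)
  then have "integral {0..2 * pi} (\<lambda>x. g x * u x + primitive g x * deriv u x) =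
      (LINT x|circle. g x * u x) + (LINT x|circle. primitive g x * deriv u x)"
    by (subst LINT_circle_eq_integral(1)[symmetric]) auto
  ultimately show ?thesis
    by simp
qed

lemma abs_LINT_mult_le:
  fixes f v :: "real \<Rightarrow> real"
  assumes f: "integrable circle f" and v: "continuous_on UNIV v"
    and B: "\<And>x. x \<in> {0..<2 * pi} \<Longrightarrow> \<bar>v x\<bar> \<le> B"
  shows "\<bar>LINT x|circle. f x * v x\<bar> \<le> B * (LINT x|circle. \<bar>f x\<bar>)"
proof -
  have "\<bar>LINT x|circle. f x * v x\<bar> \<le> (LINT x|circle. \<bar>f x * v x\<bar>)"
    by (rule integral_abs_bound)
  also have "\<dots> \<le> (LINT x|circle. B * \<bar>f x\<bar>)"
  proof (rule integral_mono)
    show "integrable circle (\<lambda>x. \<bar>f x * v x\<bar>)"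
      by (intro integrable_abs integrable_mult_continuous_circle f v)
    show "\<bar>f x * v x\<bar> \<le> B * \<bar>f x\<bar>" if "x \<in> space circle" for x
      using mult_right_mono[OF B abs_ge_zero[of "f x"], of x] that by (simp add: abs_mult mult.commute)
  qed (use f in auto)
  finally show ?thesis
    using f by simp
qed

text \<open>Extension from trigonometric polynomials by density: the defect \<open>D\<close> of the
  formula is additive and bounded by a multiple of the \<open>L1\<close> norm.\<close>

lemma by_parts:
  assumes g: "integrable circle g" and u: "test_function u"
  shows "(LINT x|circle. primitive g x * deriv u x) =
    u 0 * (LINT x|circle. g x) - (LINT x|circle. g x * u x)"
proof -
  note cont = test_function_continuous[OF u, of 0, simplified] test_function_continuous[OF u, of 1, simplified]
  obtain B where B: "0 \<le> B" "\<And>x. x \<in> {0..<2 * pi} \<Longrightarrow> \<bar>u x\<bar> \<le> B"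
    using bounded_on_circle[OF cont(1)] by blast
  obtain B' where B': "0 \<le> B'" "\<And>x. x \<in> {0..<2 * pi} \<Longrightarrow> \<bar>deriv u x\<bar> \<le> B'"
    using bounded_on_circle[OF cont(2)] by blast
  define D where "D f = (LINT x|circle. primitive f x * deriv u x) -
    (u 0 * (LINT x|circle. f x) - (LINT x|circle. f x * u x))" for f
  have D_diff: "D (\<lambda>x. f x - h x) = D f - D h" if f: "integrable circle f" and h: "integrable circle h" for f h
  proof -
    have "(LINT x|circle. primitive (\<lambda>x. f x - h x) x * deriv u x) =
        (LINT x|circle. primitive f x * deriv u x - primitive h x * deriv u x)"
      using primitive_diff[OF f h] by (intro Bochner_Integration.integral_cong) (auto simp: left_diff_distrib)
    then show ?thesis
      using f h cont
      by (simp add: D_def left_diff_distrib right_diff_distrib integrable_mult_continuous_circle integrable_primitive_mult)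
  qed
  have D_le: "\<bar>D f\<bar> \<le> (2 * pi * B' + 2 * B) * (LINT x|circle. \<bar>f x\<bar>)" if f: "integrable circle f" for f
  proof -
    let ?I = "LINT x|circle. \<bar>f x\<bar>"
    have "(LINT x|circle. \<bar>primitive f x\<bar>) \<le> (LINT x|circle. ?I)"
      using abs_primitive_le[OF f] integrable_primitive[OF f] by (intro integral_mono) auto
    then have "B' * (LINT x|circle. \<bar>primitive f x\<bar>) \<le> B' * (2 * pi * ?I)"
      unfolding LINT_const_circle by (rule mult_left_mono) (rule B')
    then have 1: "\<bar>LINT x|circle. primitive f x * deriv u x\<bar> \<le> B' * (2 * pi * ?I)"
      using abs_LINT_mult_le[OF integrable_primitive[OF f] cont(2) B'(2)] by linarith
    have 2: "\<bar>LINT x|circle. f x * u x\<bar> \<le> B * ?I"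
      by (rule abs_LINT_mult_le[OF f cont(1) B(2)])
    have 3: "\<bar>u 0 * (LINT x|circle. f x)\<bar> \<le> B * ?I"
      unfolding abs_mult using B by (intro mult_mono integral_abs_bound) auto
    have "\<bar>D f\<bar> \<le> B' * (2 * pi * ?I) + (B * ?I + B * ?I)"
      unfolding D_def using 1 2 3 by linarith
    then show ?thesis
      by (simp add: algebra_simps)
  qed
  have "\<bar>D g\<bar> \<le> e" if e: "0 < e" for e
  proof -
    define K where "K = 2 * pi * B' + 2 * B + 1"
    have K: "0 < K"
      using B B' by (simp add: K_def add_nonneg_pos)
    obtain p where p: "real_polynomial_function p" "(LINT x|circle. \<bar>g x - p (cis x)\<bar>) < e / K"
      using trig_L1_dense[OF g, of "e / K"] e K by auto
    have "D (\<lambda>x. p (cis x)) = 0"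
      unfolding D_def using by_parts_trig[OF p(1) u] by simp
    then have "\<bar>D g\<bar> = \<bar>D (\<lambda>x. g x - p (cis x))\<bar>"
      using D_diff[OF g trig_integrable[OF p(1)]] by simp
    also have "\<dots> \<le> (2 * pi * B' + 2 * B) * (LINT x|circle. \<bar>g x - p (cis x)\<bar>)"
      using g trig_integrable[OF p(1)] by (intro D_le) auto
    also have "\<dots> \<le> K * (e / K)"
      using p(2) B B' by (intro mult_mono) (auto simp: K_def)
    finally show ?thesis
      using K by simp
  qed
  then have "\<bar>D g\<bar> \<le> 0"
    by (rule field_le_epsilon[of _ 0, simplified])
  then show ?thesis
    by (simp add: D_def)
qed

text \<open>Mean zero is exactly what makes an antiderivative periodic.\<close>

lemma trig_antiderivative:
  assumes q: "real_polynomial_function q" and mean: "(LINT x|circle. q (cis x)) = 0"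
  obtains U where "test_function U" "deriv U = (\<lambda>x. q (cis x))"
proof -
  obtain U where U: "\<And>x. (U has_real_derivative q (cis x)) (at x)"
    using einterval_antiderivative[of "-\<infinity>" "\<infinity>" "\<lambda>x. q (cis x)"] trig_continuous[OF q]
    by (auto simp: continuous_on_eq_continuous_at has_real_derivative_iff_has_vector_derivative)
  then have deriv_U: "deriv U = (\<lambda>x. q (cis x))"
    by (auto intro: DERIV_imp_deriv)
  have per: "U (x + 2 * pi) = U x" for x
  proof -
    have "((\<lambda>x. U (x + 2 * pi) - U x) has_real_derivative 0) (at x)" for x
    proof -
      have "((\<lambda>x. U (x + 2 * pi)) has_real_derivative q (cis (x + 2 * pi))) (at x)"
        using U[of "x + 2 * pi"] by (simp only: DERIV_shift)
      from DERIV_diff[OF this U] show ?thesis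
        using trig_periodic[of q] by (simp add: periodic_def)
    qed
    then have "U (x + 2 * pi) - U x = U (0 + 2 * pi) - U 0"
      by (rule DERIV_isconst_all[rule_format])
    moreover have "((\<lambda>x. q (cis x)) has_integral U (2 * pi) - U 0) {0..2 * pi}"
      using U by (intro fundamental_theorem_of_calculus)
        (auto simp: has_real_derivative_iff_has_vector_derivative intro: has_vector_derivative_at_within)
    then have "U (2 * pi) - U 0 = 0"
      using mean LINT_circle_eq_integral(1)[OF trig_integrable[OF q]] by (simp add: integral_unique)
    ultimately show ?thesis by simp
  qed
  have "C_k k U" for k
  proof -
    have "(deriv ^^ i) U differentiable_on UNIV" for i
    proof (cases i)
      case 0
      then show ?thesis
        using U by (auto simp: differentiable_on_def real_differentiable_def)
    next
      case (Suc j)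
      then have "(deriv ^^ i) U = (deriv ^^ j) (\<lambda>x. q (cis x))"
        by (simp add: funpow_Suc_right deriv_U del: funpow.simps)
      then show ?thesis
        using iterated_deriv_trig[OF q, of j] trig_differentiable by auto
    qed
    then show ?thesis
      by (simp add: C_k_def differentiable_imp_continuous_on)
  qed
  then have "test_function U"
    using per by (simp add: test_function_def)
  then show ?thesis
    using deriv_U by (rule that)
qed

text \<open>The lemma of du Bois-Reymond. By parts, \<open>f - primitive g\<close> is orthogonal to
  derivatives of test functions, hence to all trigonometric polynomials of mean zero, and so it is
  constant.\<close>

lemma weak_deriv_primitive:
  assumes f: "integrable circle f" and g: "integrable circle g"
    and weak: "\<And>u. test_function u \<Longrightarrow> (LINT x|circle. f x * deriv u x) = - (LINT x|circle. g x * u x)"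
  obtains c where "AE x in circle. f x = c + primitive g x" "(LINT x|circle. g x) = 0"
proof -
  have mean: "(LINT x|circle. g x) = 0"
    using weak[OF trig_test_function[of "\<lambda>_. 1"]] by auto
  \<comment> \<open>Makes \<open>h\<close> of mean zero, so that replacing \<open>p\<close> by
    \<open>p - m\<close> does not change the integral against \<open>h\<close>.\<close>
  define c where "c = (LINT x|circle. f x - primitive g x) / (2 * pi)"
  define h where "h x = f x - primitive g x - c" for x
  have h: "integrable circle h" "(LINT x|circle. h x) = 0"
    using f integrable_primitive[OF g] by (simp_all add: h_def[abs_def] c_def)
  have "(LINT x|circle. h x * p (cis x)) = 0" if p: "real_polynomial_function p" for p
  proof -
    define m where "m = (LINT x|circle. p (cis x)) / (2 * pi)"
    define q where "q z = p z - m" for z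
    have q: "real_polynomial_function q"
      unfolding q_def diff_conv_add_uminus by (intro real_polynomial_function.intros(2,3) p)
    have q0: "(LINT x|circle. q (cis x)) = 0"
      using trig_integrable[OF p] by (simp add: q_def m_def)
    obtain U where U: "test_function U" "deriv U = (\<lambda>x. q (cis x))"
      using trig_antiderivative[OF q q0] by blast
    have int: "integrable circle (\<lambda>x. f x * q (cis x))" "integrable circle (\<lambda>x. primitive g x * q (cis x))"
      "integrable circle (\<lambda>x. q (cis x))"
      using f g trig_continuous[OF q]
      by (auto intro: integrable_mult_continuous_circle integrable_primitive_mult trig_integrable[OF q])
    have hq: "integrable circle (\<lambda>x. h x * q (cis x))"
      by (intro integrable_mult_continuous_circle h trig_continuous q)
    have "(LINT x|circle. h x * p (cis x)) = (LINT x|circle. h x * q (cis x) + m * h x)"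
      by (simp add: q_def algebra_simps)
    also have "\<dots> = (LINT x|circle. h x * q (cis x))"
      using h hq by simp
    also have "\<dots> = (LINT x|circle. f x * q (cis x)) - (LINT x|circle. primitive g x * q (cis x))"
      using int q0 by (simp add: h_def left_diff_distrib)
    also have "\<dots> = 0"
      using weak[OF U(1)] by_parts[OF g U(1)] mean unfolding U(2) by simp
    finally show ?thesis .
  qed
  then have "AE x in circle. h x = 0"
    by (rule zero_AE_of_test[OF h(1)])
  then have "AE x in circle. f x = c + primitive g x"
    by (rule eventually_mono) (simp add: h_def)
  then show ?thesis
    using mean by (rule that)
qed

text \<open>If \<open>x < y\<close> lie in different periods, go from \<open>wrap x\<close> up to
  \<open>2 * pi\<close> and from 0 up to \<open>wrap y\<close>: the values at the two ends agree,
  and the total length is at most \<open>y - x\<close>.\<close>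

lemma periodic_lipschitz:
  assumes f: "periodic f" and K: "0 \<le> K"
    and lip: "\<And>x y. x \<in> {0..2 * pi} \<Longrightarrow> y \<in> {0..2 * pi} \<Longrightarrow> \<bar>f x - f y\<bar> \<le> K * \<bar>x - y\<bar>"
  shows "\<bar>f x - f y\<bar> \<le> K * \<bar>x - y\<bar>"
proof -
  have *: "\<bar>f x - f y\<bar> \<le> K * (y - x)" if "x \<le> y" for x y
  proof -
    define m n where "m = \<lfloor>x / (2 * pi)\<rfloor>" and "n = \<lfloor>y / (2 * pi)\<rfloor>"
    have mn: "m \<le> n"
      unfolding m_def n_def using that by (intro floor_mono divide_right_mono) auto
    have xy: "x = wrap x + 2 * pi * of_int m" "y = wrap y + 2 * pi * of_int n"
      by (simp_all add: wrap_def m_def n_def)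
    have range: "wrap x \<in> {0..2 * pi}" "wrap y \<in> {0..2 * pi}"
      using wrap_range[of x] wrap_range[of y] by auto
    have wrap: "f x = f (wrap x)" "f y = f (wrap y)"
      by (simp_all add: periodic_wrap f)
    show ?thesis
    proof (cases "m = n")
      case True
      then have "\<bar>wrap x - wrap y\<bar> = y - x"
        using xy(1) xy(2)[folded True] that by linarith
      then show ?thesis
        using lip[OF range] by (simp add: wrap)
    next
      case False
      then have "1 \<le> real_of_int n - real_of_int m"
        using mn by linarith
      then have "2 * pi * 1 \<le> 2 * pi * (real_of_int n - real_of_int m)"
        by (intro mult_left_mono) auto
      then have le: "(2 * pi - wrap x) + wrap y \<le> y - x"
        using xy by (simp add: algebra_simps)
      have "f (2 * pi) = f 0"
        using f by (auto simp: periodic_def dest: spec[of _ 0])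
      then have "\<bar>f x - f y\<bar> \<le> \<bar>f (wrap x) - f (2 * pi)\<bar> + \<bar>f 0 - f (wrap y)\<bar>"
        unfolding wrap by linarith
      also have "\<dots> \<le> K * \<bar>wrap x - 2 * pi\<bar> + K * \<bar>0 - wrap y\<bar>"
        using range by (intro add_mono lip) auto
      also have "\<dots> = K * ((2 * pi - wrap x) + wrap y)"
        using range by (simp add: distrib_left)
      also have "\<dots> \<le> K * (y - x)"
        by (rule mult_left_mono[OF le K])
      finally show ?thesis .
    qed
  qed
  show ?thesis
    using *[of x y] *[of y x] by (cases "x \<le> y") (auto simp: abs_minus_commute)
qed

text \<open>Integrating twice: the second weak derivative bounds the first one uniformly, and a bound on the
  first one is a Lipschitz constant.\<close>

lemma sobolev_2_lipschitz:
  assumes F: "F \<in> sobolev 2"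
  obtains f where "periodic f" "integrable circle f" "F = abs_L1 f"
    "\<And>x y. \<bar>f x - f y\<bar> \<le> 2 * sobolev_norm 2 F * \<bar>x - y\<bar>"
proof -
  have "\<exists>G. has_weak_deriv i F G" if "i \<le> 2" for i
    using F that by (simp add: sobolev_def)
  then obtain H1 H2 where H: "has_weak_deriv 1 F H1" "has_weak_deriv 2 F H2"
    by (meson one_le_numeral order_refl)
  obtain f where f: "integrable circle f" "F = abs_L1 f" by (rule L1_cases)
  obtain h1 where h1: "integrable circle h1" "H1 = abs_L1 h1" by (rule L1_cases)
  obtain h2 where h2: "integrable circle h2" "H2 = abs_L1 h2" by (rule L1_cases)
  have w1: "(LINT x|circle. f x * deriv u x) = - (LINT x|circle. h1 x * u x)"
    and w2: "(LINT x|circle. f x * deriv (deriv u) x) = (LINT x|circle. h2 x * u x)"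
    if "test_function u" for u
    using H f h1 h2 that by (auto simp: has_weak_deriv_abs_L1 numeral_2_eq_2)
  \<comment> \<open>Membership in \<open>sobolev\<close> relates each derivative to \<open>F\<close>
    only; testing with \<open>deriv u\<close> identifies \<open>h2\<close> as the weak derivative of
    \<open>h1\<close>.\<close>
  have "(LINT x|circle. h1 x * deriv u x) = - (LINT x|circle. h2 x * u x)" if "test_function u" for u
    using w1[OF test_function_deriv_test[OF that]] w2[OF that] by simp
  then obtain c1 where c1: "AE x in circle. h1 x = c1 + primitive h2 x"
    using weak_deriv_primitive[OF h1(1) h2(1)] by blast
  obtain c where c: "AE x in circle. f x = c + primitive h1 x" and mean: "(LINT x|circle. h1 x) = 0"
    using weak_deriv_primitive[OF f(1) h1(1)] w1 by blast
  define K where "K = sobolev_norm 2 F"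
  have K: "(LINT x|circle. \<bar>h2 x\<bar>) \<le> K"
    using norm_weak_deriv_le_sobolev_norm[OF H(2), of 2] h2 by (simp add: K_def norm_abs_L1)
  have "0 \<le> (LINT x|circle. \<bar>h2 x\<bar>)"
    by (simp add: integral_nonneg_AE)
  then have K0: "0 \<le> K"
    using K by linarith
  have G2: "\<bar>primitive h2 x\<bar> \<le> K" if "x \<in> {0..2 * pi}" for x
    using abs_primitive_le[OF h2(1) that] K by linarith
  \<comment> \<open>As \<open>h1\<close> has mean zero, \<open>c1\<close> is minus the mean of
    \<open>primitive h2\<close> and obeys the same bound \<open>K\<close>. This is the origin of the
    factor 2.\<close>
  have "(LINT x|circle. h1 x) = (LINT x|circle. c1 + primitive h2 x)"
    using c1 h1 integrable_primitive[OF h2(1)] by (intro integral_cong_AE) auto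
  then have "2 * pi * c1 = - (LINT x|circle. primitive h2 x)"
    using integrable_primitive[OF h2(1)] mean by simp
  then have "\<bar>2 * pi * c1\<bar> = \<bar>LINT x|circle. primitive h2 x\<bar>"
    by (metis abs_minus_cancel)
  then have "2 * pi * \<bar>c1\<bar> = \<bar>LINT x|circle. primitive h2 x\<bar>"
    by (simp add: abs_mult)
  also have "\<dots> \<le> (LINT x|circle. \<bar>primitive h2 x\<bar>)"
    by (rule integral_abs_bound)
  also have "\<dots> \<le> (LINT x|circle. K)"
    using G2 integrable_primitive[OF h2(1)] by (intro integral_mono) auto
  also have "\<dots> = 2 * pi * K"
    by (rule LINT_const_circle)
  finally have c1_le: "\<bar>c1\<bar> \<le> K"
    by (rule mult_left_le_imp_le) simp
  \<comment> \<open>\<open>h1\<close> is bounded by \<open>2 * K\<close> only almost everywhere,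
    whereas \<open>primitive_increment_le\<close> asks for a bound at every point. The modification
    leaves the primitive unchanged.\<close>
  define g where "g x = (if \<bar>h1 x\<bar> \<le> 2 * K then h1 x else 0)" for x
  have g_bound: "\<bar>g x\<bar> \<le> 2 * K" for x
    using K0 by (simp add: g_def)
  have [measurable]: "h1 \<in> borel_measurable circle"
    using h1 by simp
  have "g \<in> borel_measurable circle"
    unfolding g_def by measurable
  then have g: "integrable circle g"
    using g_bound by (rule integrable_bounded_circle)
  have "AE x in circle. x \<in> {0..<2 * pi}"
    using AE_space[of circle] by simp
  with c1 have ae: "AE x in circle. h1 x = g x"
  proof eventually_elim
    fix x assume "h1 x = c1 + primitive h2 x" "x \<in> {0..<2 * pi}"
    then have "\<bar>h1 x\<bar> \<le> 2 * K"
      using G2[of x] c1_le by auto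
    then show "h1 x = g x" by (simp add: g_def)
  qed
  have "(LINT x|circle. g x) = (LINT x|circle. h1 x)"
    using ae h1 g by (intro integral_cong_AE) auto
  then have g_mean: "(LINT x|circle. g x) = 0"
    using mean by simp
  have "(LINT x|circle. \<bar>h1 x - g x\<bar>) = (LINT x|circle. 0)"
    using ae h1 g by (intro integral_cong_AE) auto
  then have g_eq: "(LINT x|circle. \<bar>h1 x - g x\<bar>) = 0"
    by simp
  have prim: "primitive h1 x = primitive g x" if x: "x \<in> {0..2 * pi}" for x
    using abs_primitive_le[of "\<lambda>x. h1 x - g x" x] primitive_diff[OF h1(1) g x] h1 g x g_eq by simp
  \<comment> \<open>Wrapping extends the representative to the line; mean zero of \<open>g\<close>
    prevents a jump at the ends of the period.\<close>
  define F' where "F' x = c + primitive g (wrap x)" for x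
  have ends: "primitive g (2 * pi) = primitive g 0"
    using g g_mean by (simp add: primitive_2pi primitive_0)
  have wrap_2pi: "wrap (2 * pi) = 0"
    by (simp add: wrap_def)
  have F': "F' x = c + primitive g x" if "x \<in> {0..2 * pi}" for x
    using that wrap_id[of x] ends wrap_2pi by (cases "x = 2 * pi") (auto simp: F'_def)
  have per: "periodic F'"
    using wrap_shift[of _ 1] by (simp add: periodic_def F'_def)
  have lip: "\<bar>F' x - F' y\<bar> \<le> 2 * K * \<bar>x - y\<bar>" for x y
  proof (rule periodic_lipschitz[OF per])
    show "\<bar>F' x - F' y\<bar> \<le> 2 * K * \<bar>x - y\<bar>" if "x \<in> {0..2 * pi}" "y \<in> {0..2 * pi}" for x y
      using primitive_increment_le[OF g that g_bound] by (simp only: F'[OF that(1)] F'[OF that(2)] add_diff_cancel_left)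
  qed (use K0 in simp)
  have "continuous_on UNIV F'"
  proof (rule lipschitz_on_continuous_on)
    show "(2 * K)-lipschitz_on UNIV F'"
      using lip K0 by (auto intro!: lipschitz_onI simp: dist_real_def)
  qed
  then have int: "integrable circle F'"
    by (rule integrable_continuous_circle)
  have "AE x in circle. x \<in> {0..<2 * pi}"
    using AE_space[of circle] by simp
  with c have "AE x in circle. f x = F' x"
    by eventually_elim (simp add: F' prim)
  then have "F = abs_L1 F'"
    using f int by (auto intro: abs_L1_eqI)
  with per int show ?thesis
    using lip unfolding K_def by (rule that)
qed

section \<open>Invariant densities\<close>

text \<open>Iteration leaves a multiple \<open>(1 - \<epsilon>) ^ n\<close> of an iterate of
  \<open>G\<close> plus \<epsilon> times a weighted sum of iterates of \<open>F\<close>. The first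
  term vanishes in the limit by contraction alone; the weights are bounded by 1, which keeps
  \<open>A / (1 - q)\<close> independent of \<epsilon>.\<close>

lemma perturbed_fixed_point_bound:
  fixes L :: "'a::real_normed_vector \<Rightarrow> 'a"
  assumes L: "linear L" "\<And>x. norm (L x) \<le> norm x"
    and fixed: "G = (1 - \<epsilon>) *\<^sub>R L G + \<epsilon> *\<^sub>R F" and \<epsilon>: "0 < \<epsilon>" "\<epsilon> \<le> 1"
    and decay: "\<And>n. norm ((L ^^ n) F) \<le> A * q ^ n" and q: "0 \<le> q" "q < 1"
  shows "norm G \<le> \<epsilon> * (A / (1 - q))"
proof -
  have A: "0 \<le> A"
    using order_trans[OF norm_ge_zero decay[of 0]] by simp
  have step: "norm ((L ^^ n) G) \<le> (1 - \<epsilon>) * norm ((L ^^ Suc n) G) + \<epsilon> * (A * q ^ n)" for n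
  proof -
    have "(L ^^ n) G = (1 - \<epsilon>) *\<^sub>R (L ^^ n) (L G) + \<epsilon> *\<^sub>R (L ^^ n) F"
      by (subst fixed) (simp add: linear_add linear_scale linear_funpow[OF L(1)])
    then have "norm ((L ^^ n) G) \<le> norm ((1 - \<epsilon>) *\<^sub>R (L ^^ n) (L G)) + norm (\<epsilon> *\<^sub>R (L ^^ n) F)"
      by (metis norm_triangle_ineq)
    also have "\<dots> = (1 - \<epsilon>) * norm ((L ^^ n) (L G)) + \<epsilon> * norm ((L ^^ n) F)"
      using \<epsilon> by simp
    also have "\<dots> \<le> (1 - \<epsilon>) * norm ((L ^^ n) (L G)) + \<epsilon> * (A * q ^ n)"
      using \<epsilon> decay by (intro add_left_mono mult_left_mono) auto
    finally show ?thesis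
      by (simp only: funpow_Suc_right o_apply)
  qed
  have contract: "norm ((L ^^ n) G) \<le> norm G" for n
    by (induction n) (auto intro: order_trans[OF L(2)])
  have "norm G \<le> (1 - \<epsilon>) ^ n * norm ((L ^^ n) G) + \<epsilon> * (A * (\<Sum>i<n. q ^ i))" for n
  proof (induction n)
    case (Suc n)
    have "(1 - \<epsilon>) ^ n * norm ((L ^^ n) G)
        \<le> (1 - \<epsilon>) ^ n * ((1 - \<epsilon>) * norm ((L ^^ Suc n) G) + \<epsilon> * (A * q ^ n))"
      using \<epsilon> step by (intro mult_left_mono) auto
    also have "\<dots> = (1 - \<epsilon>) ^ Suc n * norm ((L ^^ Suc n) G) + (1 - \<epsilon>) ^ n * (\<epsilon> * (A * q ^ n))"
      by (simp add: algebra_simps)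
    also have "(1 - \<epsilon>) ^ n * (\<epsilon> * (A * q ^ n)) \<le> 1 * (\<epsilon> * (A * q ^ n))"
      using \<epsilon> A q by (intro mult_right_mono power_le_one) auto
    finally show ?case
      using Suc.IH by (simp add: distrib_left)
  qed simp
  moreover have "(1 - \<epsilon>) ^ n * norm ((L ^^ n) G) + \<epsilon> * (A * (\<Sum>i<n. q ^ i))
      \<le> (1 - \<epsilon>) ^ n * norm G + \<epsilon> * (A / (1 - q))" for n
  proof -
    have "(\<Sum>i<n. q ^ i) = (1 - q ^ n) / (1 - q)"
      using q by (simp add: sum_gp_strict)
    also have "\<dots> \<le> 1 / (1 - q)"
      using q by (intro divide_right_mono) auto
    finally have "A * (\<Sum>i<n. q ^ i) \<le> A * (1 / (1 - q))"
      using A by (rule mult_left_mono)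
    then have "\<epsilon> * (A * (\<Sum>i<n. q ^ i)) \<le> \<epsilon> * (A / (1 - q))"
      using \<epsilon> by (intro mult_left_mono) auto
    moreover have "(1 - \<epsilon>) ^ n * norm ((L ^^ n) G) \<le> (1 - \<epsilon>) ^ n * norm G"
      using \<epsilon> contract by (intro mult_left_mono) auto
    ultimately show ?thesis by simp
  qed
  ultimately have "\<forall>n. norm G \<le> (1 - \<epsilon>) ^ n * norm G + \<epsilon> * (A / (1 - q))"
    by (meson order_trans)
  moreover have "(\<lambda>n. (1 - \<epsilon>) ^ n * norm G + \<epsilon> * (A / (1 - q))) \<longlonglongrightarrow> 0 * norm G + \<epsilon> * (A / (1 - q))"
    using \<epsilon> by (intro tendsto_intros LIMSEQ_power_zero) auto
  ultimately show ?thesis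
    by (auto intro: LIMSEQ_le_const)
qed

context expanding_circle_map
begin

text \<open>An invariant difference equals all its iterates. Contraction carries the approximation
  error along unchanged while the Lipschitz approximant decays, so \<open>n\<close> goes to infinity
  before \<open>e\<close> goes to 0.\<close>

lemma invariant_density_unique:
  assumes inv: "transfer_operator T F = F" "transfer_operator T G = G"
    and integral: "integral_L1 F = integral_L1 G"
  shows "F = G"
proof -
  let ?L = "transfer_operator T"
  define D where "D = F - G"
  obtain f where f: "integrable circle f" "D = abs_L1 f" by (rule L1_cases)
  have "?L D = D"
    using inv by (simp add: D_def linear_diff[OF linear_transfer_operator])
  then have fixed: "(?L ^^ n) D = D" for n
    by (induction n) auto
  have "integral_L1 D = 0"
    using integral by (simp add: D_def integral_L1_diff)
  then have f0: "(LINT x|circle. f x) = 0"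
    using f by (simp add: integral_abs_L1)
  have contract: "norm ((?L ^^ n) H) \<le> norm H" for n H
    by (induction n) (auto intro: order_trans[OF norm_transfer_operator_le])
  have "norm D \<le> e" if e: "0 < e" for e
  proof -
    obtain p where p: "real_polynomial_function p" "(LINT x|circle. \<bar>f x - p (cis x)\<bar>) < e / 2"
      using trig_L1_dense[OF f(1), of "e / 2"] e by auto
    \<comment> \<open>Decay asks for mean zero, so the mean of \<open>p\<close> is removed. As
      \<open>f\<close> has mean zero, this costs at most the approximation error once more, hence
      the choice of \<open>e / 2\<close>.\<close>
    define m where "m = (LINT x|circle. p (cis x)) / (2 * pi)"
    define q where "q z = p z + - m" for z
    have q: "real_polynomial_function q"
      unfolding q_def by (intro real_polynomial_function.intros(2,3) p)
    have q0: "(LINT x|circle. q (cis x)) = 0"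
      using trig_integrable[OF p(1)] by (simp add: q_def m_def)
    obtain K where K: "0 < K" "\<And>x y. \<bar>q (cis x) - q (cis y)\<bar> \<le> K * \<bar>x - y\<bar>"
      using trig_lipschitz[OF q] by blast
    define Q where "Q = abs_L1 (\<lambda>x. q (cis x))"
    have "2 * pi * \<bar>m\<bar> = \<bar>LINT x|circle. f x - p (cis x)\<bar>"
      using f f0 trig_integrable[OF p(1)] by (simp add: m_def abs_divide)
    also have "\<dots> \<le> (LINT x|circle. \<bar>f x - p (cis x)\<bar>)"
      by (rule integral_abs_bound)
    finally have m: "2 * pi * \<bar>m\<bar> \<le> (LINT x|circle. \<bar>f x - p (cis x)\<bar>)" .
    have "norm (D - Q) = (LINT x|circle. \<bar>f x - q (cis x)\<bar>)"
      using f trig_integrable[OF q] by (simp add: Q_def minus_abs_L1 norm_abs_L1)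
    also have "\<dots> \<le> (LINT x|circle. \<bar>f x - p (cis x)\<bar> + \<bar>m\<bar>)"
      using f trig_integrable[OF q] trig_integrable[OF p(1)] by (intro integral_mono) (auto simp: q_def)
    also have "\<dots> = (LINT x|circle. \<bar>f x - p (cis x)\<bar>) + 2 * pi * \<bar>m\<bar>"
      using f trig_integrable[OF p(1)] by simp
    also have "\<dots> \<le> e"
      using m p(2) by simp
    finally have DQ: "norm (D - Q) \<le> e" .
    have "norm D \<le> e + 4 * pi * (2 * pi + 1 / a\<^sub>0) * K * (1 - coupling) ^ n" for n
    proof -
      have "D = (?L ^^ n) (D - Q) + (?L ^^ n) Q"
        by (simp add: linear_diff[OF linear_funpow[OF linear_transfer_operator]] fixed)
      then have "norm D \<le> norm ((?L ^^ n) (D - Q)) + norm ((?L ^^ n) Q)"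
        by (metis norm_triangle_ineq)
      also have "\<dots> \<le> e + 4 * pi * (2 * pi + 1 / a\<^sub>0) * K * (1 - coupling) ^ n"
        unfolding Q_def
        by (intro add_mono exponential_decay[OF trig_periodic K(2,1) trig_integrable[OF q] q0]
            order_trans[OF contract DQ[unfolded Q_def]])
      finally show ?thesis .
    qed
    moreover have "(\<lambda>n. e + 4 * pi * (2 * pi + 1 / a\<^sub>0) * K * (1 - coupling) ^ n)
        \<longlonglongrightarrow> e + 4 * pi * (2 * pi + 1 / a\<^sub>0) * K * 0"
      using coupling_bounds by (intro tendsto_intros LIMSEQ_power_zero) auto
    ultimately show ?thesis
      by (auto intro: LIMSEQ_le_const)
  qed
  then have "norm D \<le> 0"
    by (rule field_le_epsilon[of _ 0, simplified])
  then show ?thesis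
    by (simp add: D_def)
qed

text \<open>The Lipschitz constants of the two representatives are added, so only the separate
  Sobolev norms of \<open>F\<close> and \<open>G\<close> enter.\<close>

lemma sobolev_decay:
  assumes F: "F \<in> sobolev 2" and G: "G \<in> sobolev 2" and integral: "integral_L1 F = integral_L1 G"
    and K: "2 * sobolev_norm 2 F + 2 * sobolev_norm 2 G \<le> K" "0 < K"
  shows "norm ((transfer_operator T ^^ n) (F - G)) \<le> 4 * pi * (2 * pi + 1 / a\<^sub>0) * K * (1 - coupling) ^ n"
proof -
  obtain f where f: "periodic f" "integrable circle f" "F = abs_L1 f"
    "\<And>x y. \<bar>f x - f y\<bar> \<le> 2 * sobolev_norm 2 F * \<bar>x - y\<bar>"
    using sobolev_2_lipschitz[OF F] by blast
  obtain g where g: "periodic g" "integrable circle g" "G = abs_L1 g"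
    "\<And>x y. \<bar>g x - g y\<bar> \<le> 2 * sobolev_norm 2 G * \<bar>x - y\<bar>"
    using sobolev_2_lipschitz[OF G] by blast
  define h where "h x = f x - g x" for x
  have lip: "\<bar>h x - h y\<bar> \<le> K * \<bar>x - y\<bar>" for x y
  proof -
    have "\<bar>h x - h y\<bar> \<le> \<bar>f x - f y\<bar> + \<bar>g x - g y\<bar>"
      by (simp add: h_def)
    also have "\<dots> \<le> (2 * sobolev_norm 2 F + 2 * sobolev_norm 2 G) * \<bar>x - y\<bar>"
      using f(4)[of x y] g(4)[of x y] by (simp add: distrib_right)
    also have "\<dots> \<le> K * \<bar>x - y\<bar>"
      using K by (intro mult_right_mono) auto
    finally show ?thesis .
  qed
  have "periodic h"
    using f(1) g(1) by (simp add: periodic_def h_def)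
  moreover have "integrable circle h" "(LINT x|circle. h x) = 0"
    using f g integral by (simp_all add: h_def[abs_def] integral_abs_L1)
  moreover have "F - G = abs_L1 h"
    using f g by (simp add: minus_abs_L1 h_def[abs_def])
  ultimately show ?thesis
    using exponential_decay[of h K n] lip K by simp
qed

end

theorem proposition15:
  fixes T :: "real \<Rightarrow> real" and h0 \<phi>' :: L1 and \<psi> d\<psi> :: "L1 \<Rightarrow> L1" and C :: real
  assumes T: "C4_circle_map T" "uniformly_expanding T"
    and h0: "h0 \<in> invariant_densities (transfer_operator T)" "h0 \<in> sobolev 3" "W h0 = 0"
    and \<psi>: "\<And>\<phi>. \<psi> \<phi> \<in> prob_densities \<inter> sobolev 2"
    and \<psi>_bounded: "bdd_above ((\<lambda>\<phi>. sobolev_norm 2 (\<psi> \<phi>)) ` prob_densities)"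
    and \<psi>_lipschitz: "C \<ge> 0"
      "\<And>\<phi> g. \<phi> \<in> prob_densities \<Longrightarrow> g \<in> zero_mean \<Longrightarrow>
         sobolev_norm 1 (\<psi> (\<phi> + g) - \<psi> \<phi>) \<le> C * norm g"
    and \<phi>': "W \<phi>' > 0"
    and d\<psi>: "bounded_linear_sobolev 2 d\<psi>"
      "((\<lambda>g. sobolev_norm 1 (\<psi> (\<phi>' + g) - \<psi> \<phi>' - d\<psi> g) / norm g) \<longlongrightarrow> 0) (at 0 within zero_mean)"
      "sobolev_onorm 1 d\<psi> < 1"
  shows "\<exists>\<delta>'. 0 < \<delta>' \<and> \<delta>' < 1 \<and>
    (\<forall>\<delta>. 0 \<le> \<delta> \<and> \<delta> \<le> \<delta>' \<longrightarrow> invariant_densities (L_self_consistent T \<psi> \<delta>) = {h0})"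
proof -
  let ?L = "transfer_operator T"
  obtain d \<sigma> M where "expanding_lift T (deriv T) d \<sigma> M"
    using expanding_liftI[OF T] by blast
  then interpret expanding_circle_map T d \<sigma> M
    by (rule expanding_circle_map.intro)
  have h0_inv: "?L h0 = h0" "h0 \<in> prob_densities"
    using h0(1) by (auto simp: invariant_densities_def)
  have h0_sobolev: "h0 \<in> sobolev 2"
    using h0(2) by (simp add: sobolev_def)
  have integral: "integral_L1 F = 1" if "F \<in> prob_densities" for F
    using that by (simp add: prob_densities_def)
  obtain N where N: "\<And>\<phi>. \<phi> \<in> prob_densities \<Longrightarrow> sobolev_norm 2 (\<psi> \<phi>) \<le> N"
    using \<psi>_bounded by (auto simp: bdd_above_def)
  define K where "K = max 1 (2 * N + 2 * sobolev_norm 2 h0)"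
  \<comment> \<open>The constant \<open>A / (1 - q)\<close> of
    \<open>perturbed_fixed_point_bound\<close> for \<open>q = 1 - coupling\<close>.\<close>
  define A where "A = 4 * pi * (2 * pi + 1 / a\<^sub>0) * K / coupling"
  have "0 < K"
    by (simp add: K_def)
  then have A: "0 < A"
    using a\<^sub>0_pos coupling_bounds by (simp add: A_def add_pos_pos)
  \<comment> \<open>Secures \<open>\<delta>' < 1\<close> and \<open>\<delta>' * A < 1\<close> at
    once.\<close>
  define \<delta>' where "\<delta>' = 1 / (2 * (1 + A))"
  have \<delta>': "0 < \<delta>'" "\<delta>' < 1" "\<delta>' * A < 1"
    using A by (simp_all add: \<delta>'_def field_simps)
  have "invariant_densities (L_self_consistent T \<psi> \<delta>) = {h0}" if \<delta>: "0 \<le> \<delta>" "\<delta> \<le> \<delta>'" for \<delta>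
  proof (intro equalityI subsetI)
    fix f assume "f \<in> {h0}"
    then show "f \<in> invariant_densities (L_self_consistent T \<psi> \<delta>)"
      using h0_inv h0(3) by (simp add: invariant_densities_def L_self_consistent_def L_frozen_def)
  next
    fix f assume "f \<in> invariant_densities (L_self_consistent T \<psi> \<delta>)"
    then have f: "f \<in> prob_densities" "L_self_consistent T \<psi> \<delta> f = f"
      by (auto simp: invariant_densities_def)
    define \<epsilon> where "\<epsilon> = \<delta> * W f"
    have W: "0 \<le> W f" "W f \<le> 1"
      using W_nonneg W_prob_density_le_1[OF f(1)] by auto
    \<comment> \<open>This selects the first case of \<open>L_frozen\<close>.\<close>
    have \<epsilon>: "0 \<le> \<epsilon>" "\<epsilon> \<le> 1"
      using W \<delta> \<delta>' mult_mono[of \<delta> 1 "W f" 1] by (auto simp: \<epsilon>_def)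
    have eq: "f = (1 - \<epsilon>) *\<^sub>R ?L f + \<epsilon> *\<^sub>R \<psi> f"
      using f(2) \<epsilon> integral[OF f(1)] by (simp add: L_self_consistent_def L_frozen_def \<epsilon>_def)
    have "\<epsilon> = 0"
    proof (rule ccontr)
      assume "\<epsilon> \<noteq> 0"
      then have pos: "0 < \<epsilon>" "0 < W f"
        using \<epsilon> W by (auto simp: \<epsilon>_def less_le)
      have "norm (f - h0) \<le> \<epsilon> * (4 * pi * (2 * pi + 1 / a\<^sub>0) * K / (1 - (1 - coupling)))"
      proof (rule perturbed_fixed_point_bound[OF linear_transfer_operator norm_transfer_operator_le])
        \<comment> \<open>Splitting \<open>h0\<close> with weights \<open>1 - \<epsilon>\<close> and
          \<epsilon>, and applying its invariance to the first part only, gives the equation for the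
          difference.\<close>
        have "f - h0 = (1 - \<epsilon>) *\<^sub>R ?L f + \<epsilon> *\<^sub>R \<psi> f - ((1 - \<epsilon>) *\<^sub>R h0 + \<epsilon> *\<^sub>R h0)"
          by (simp only: eq[symmetric] scaleR_collapse)
        also have "\<dots> = (1 - \<epsilon>) *\<^sub>R ?L (f - h0) + \<epsilon> *\<^sub>R (\<psi> f - h0)"
          by (simp add: linear_diff[OF linear_transfer_operator] h0_inv(1) scaleR_diff_right del: scaleR_collapse)
        finally show "f - h0 = (1 - \<epsilon>) *\<^sub>R ?L (f - h0) + \<epsilon> *\<^sub>R (\<psi> f - h0)" .
        show "norm ((?L ^^ n) (\<psi> f - h0)) \<le> 4 * pi * (2 * pi + 1 / a\<^sub>0) * K * (1 - coupling) ^ n" for n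
          using \<psi>[of f] h0_sobolev N[OF f(1)] integral h0_inv(2)
          by (intro sobolev_decay) (auto simp: K_def)
      qed (use pos \<epsilon> coupling_bounds in auto)
      then have "norm (f - h0) \<le> \<delta> * A * W f"
        by (simp add: \<epsilon>_def A_def mult_ac)
      then have "(norm (f - h0))\<^sup>2 \<le> (\<delta> * A * W f)\<^sup>2"
        by (intro power_mono) auto
      then have "W f \<le> (\<delta> * A)\<^sup>2 * (W f)\<^sup>2"
        using W_le_norm_diff[OF h0(3), of f] by (simp add: power_mult_distrib)
      also have "\<dots> \<le> (\<delta> * A)\<^sup>2 * W f"
        using W by (intro mult_left_mono) (auto simp: power2_eq_square intro: mult_left_le)
      finally have "1 \<le> (\<delta> * A)\<^sup>2"
        using pos by simp
      moreover have "\<delta> * A < 1"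
        using mult_right_mono[OF \<delta>(2) less_imp_le[OF A]] \<delta>'(3) by linarith
      then have "(\<delta> * A)\<^sup>2 < 1"
        using \<delta> A by (intro power_less_one_iff[THEN iffD2]) auto
      ultimately show False by simp
    qed
    then have "?L f = f"
      using eq by simp
    then show "f \<in> {h0}"
      using invariant_density_unique[of f h0] h0_inv integral f(1) by simp
  qed
  then show ?thesis
    using \<delta>' by blast
qed

end
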